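(* Consider the linear model $y(t)=\sum_{i=1}^m\theta_if_i(t)+\varepsilon(t)$, $t\in\mathcal{I}$, with $f_1,\dots,f_m$ linearly independent rational functions with finite values on $\mathcal{I}$ and errors of variance $1/\omega(t)$, where $\omega$ is a rational function whose numerator and denominator are both positive on $\mathcal{I}$. Let $n_\omega$ and $d_\omega$ be the degrees of the numerator and denominator of $\omega$, let $n_i$ and $d_i$ be the degrees of the numerator and denominator of $f_i$, and let $d_{\mathrm{den}}$ be the degree of $\operatorname{lcm}(\operatorname{den}(\omega),\operatorname{den}(f_1^2),\dots,\operatorname{den}(f_m^2))$. Suppose that $\mathcal{I}\subset\mathbb{R}$ is the union of $k_1+k_2$ disjoint closed bounded intervals, $k_1$ of which are singletons (the remaining $k_2$ intervals have distinct endpoints). Then for every admissible criterion $\Phi$ for which the optimal solution to the problem (P) defined in the context does not have $\pi=0$, there is a $\Phi$-optimal design supported on not more than $$\min\Big(\tfrac12(k_1+2k_2+\deg\pi),\ \deg\pi\Big)$$ points, where $$\deg\pi=d_{\mathrm{den}}+\Big(n_\omega-d_\omega+2\max_i(n_i-d_i)\Big)_+ .$$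
   Context: $\mathbb{S}^m$ is the space of real symmetric $m\times m$ matrices, $\mathbb{S}^m_+$ the cone of positive semidefinite ones, and $A\succcurlyeq B$ means that $A-B$ is positive semidefinite. $\langle\cdot,\cdot\rangle$ is the Frobenius inner product, $C^*$ is the adjoint of a linear operator $C$, and $(x)_+=\max(x,0)$. $\operatorname{den}(r)$ is the denominator of the rational function $r$, and $\operatorname{lcm}$ is the least common multiple of polynomials. In the model the errors are uncorrelated and normal with mean $0$; $f=(f_1,\dots,f_m)^{\mathrm T}$. A design is a finitely supported probability measure $\xi$ on $\mathcal{I}$; its Fisher information matrix is $M(\xi)=\int_{\mathcal{I}}f(t)f(t)^{\mathrm T}\omega(t)\,d\xi(t)$. $\xi_t$ is the unit point mass at $t$. A design is $\Phi$-optimal if it maximizes $\Phi(M(\xi))$ over all designs $\xi$ on $\mathcal{I}$. $\Phi:\mathbb{S}^m_+\to\mathbb{R}$ is semidefinite representable if for some $p,\kappa_1,\dots,\kappa_p\ge1$ and $l\ge0$ there are linear maps $A_i:\mathbb{S}^m\to\mathbb{S}^{\kappa_i}$, $C_i:\mathbb{R}^l\to\mathbb{S}^{\kappa_i}$ and matrices $B_i,D_i\in\mathbb{S}^{\kappa_i}$ such that for all $X\in\mathbb{S}^m_+$ and $z\in\mathbb{R}$: $\Phi(X)\ge z$ if and only if there exists $u\in\mathbb{R}^l$ with $A_i(X)+B_iz+C_i(u)+D_i\succcurlyeq0$ for $i=1,\dots,p$. An admissible criterion is a semidefinite representable $\Phi$ having such a representation for which there exist $\hat X\in\mathcal{M}=\operatorname{conv}\{f(t)f(t)^{\mathrm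 T}\omega(t)\mid t\in\mathcal{I}\}$, $z\in\mathbb{R}$, $u\in\mathbb{R}^l$ making all $p$ left-hand sides positive definite simultaneously; this representation is used in (P). Problem (P): minimize $y$ over $y\in\mathbb{R}$, $W_i\in\mathbb{S}^{\kappa_i}_+$ ($i=1,\dots,p$) and a polynomial $\pi$, subject to $\sum_{i=1}^p\langle W_i,B_i\rangle=-1$, $\sum_{i=1}^pC_i^*(W_i)=0$, $$\pi(t)=\operatorname{lcm}\big(\operatorname{den}(\omega),\operatorname{den}(f_1^2),\dots,\operatorname{den}(f_m^2)\big)\Big(y-\sum_{i=1}^p\langle W_i,A_i(M(\xi_t))+D_i\rangle\Big),$$ and $\pi(t)\ge0$ for all $t\in\mathcal{I}$.
   Formalization: Two assumptions are added, without which the claim is false: the denominator of ω is coprime to that of every f_i (stated as den(f_i²ω) dividing the lcm), and the superlevel sets of Φ on 𝓜 are closed, so that a Φ-optimal design exists. *)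

theory Defs
  imports
    "HOL-Probability.Probability"
    "HOL-Computational_Algebra.Computational_Algebra"
    "HOL-Computational_Algebra.Field_as_Ring"
begin

section \<open>Rational functions\<close>

text \<open>
  Real rational functions are elements of the field of fractions \<^typ>\<open>real poly fract\<close>.
  Numerator and denominator are those of the representation in lowest terms
  with monic denominator.
\<close>

definition rf_num :: "real poly fract \<Rightarrow> real poly" where
  "rf_num r = fst (quot_of_fract r)"

definition rf_den :: "real poly fract \<Rightarrow> real poly" where
  "rf_den r = snd (quot_of_fract r)"

definition rf_eval :: "real poly fract \<Rightarrow> real \<Rightarrow> real" where
  "rf_eval r t = poly (rf_num r) t / poly (rf_den r) t"

definition rf_finite_on :: "real set \<Rightarrow> real poly fract \<Rightarrow> bool" where
  "rf_finite_on I r \<longleftrightarrow> (\<forall>t\<in>I. poly (rf_den r) t \<noteq> 0)"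

text \<open>
  The reduced numerator and denominator are determined up to a common constant factor
  only, and the monic normalisation can make both of them negative; hence the
  existential quantifier.
\<close>

definition rf_num_den_pos_on :: "real set \<Rightarrow> real poly fract \<Rightarrow> bool" where
  "rf_num_den_pos_on I r \<longleftrightarrow>
     (\<exists>p q. coprime p q \<and> q \<noteq> 0 \<and> r = Fraction_Field.Fract p q \<and>
        (\<forall>t\<in>I. poly p t > 0 \<and> poly q t > 0))"

text \<open>Linear independence over the real numbers, as rational functions.\<close>

definition rf_lin_indep :: "('m::finite \<Rightarrow> real poly fract) \<Rightarrow> bool" where
  "rf_lin_indep f \<longleftrightarrow>
     (\<forall>c :: 'm \<Rightarrow> real. (\<Sum>i\<in>UNIV. Fraction_Field.Fract [:c i:] 1 * f i) = 0 \<longrightarrow> (\<forall>i. c i = 0))"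

text \<open>
  The least common multiple of polynomials is determined up to a constant factor.
  \<^const>\<open>Lcm\<close> returns the monic one, which may be negative on \<open>I\<close>; the sign matters
  for the constraint \<open>\<pi> \<ge> 0\<close> below, which is meant to be the inequality
  \<open>y \<ge> \<dots>\<close> multiplied by a positive denominator.
\<close>

definition common_den ::
    "real set \<Rightarrow> ('m::finite \<Rightarrow> real poly fract) \<Rightarrow> real poly fract \<Rightarrow> real poly" where
  "common_den I f \<omega> =
     (let L = Lcm (insert (rf_den \<omega>) (range (\<lambda>i. rf_den ((f i)\<^sup>2))))
      in if \<forall>t\<in>I. poly L t < 0 then - L else L)"

definition deg_diff :: "real poly fract \<Rightarrow> int" where
  "deg_diff r = int (degree (rf_num r)) - int (degree (rf_den r))"

definition deg_bound ::
    "real set \<Rightarrow> ('m::finite \<Rightarrow> real poly fract) \<Rightarrow> real poly fract \<Rightarrow> int" where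
  "deg_bound I f \<omega> =
     int (degree (common_den I f \<omega>)) +
     max 0 (deg_diff \<omega> + 2 * Max (range (\<lambda>i. deg_diff (f i))))"


section \<open>Designs\<close>

definition design :: "real set \<Rightarrow> real pmf \<Rightarrow> bool" where
  "design I \<xi> \<longleftrightarrow> finite (set_pmf \<xi>) \<and> set_pmf \<xi> \<subseteq> I"

definition info_at ::
    "('m::finite \<Rightarrow> real poly fract) \<Rightarrow> real poly fract \<Rightarrow> real \<Rightarrow> real^'m^'m" where
  "info_at f \<omega> t = (\<chi> i j. rf_eval (f i) t * rf_eval (f j) t * rf_eval \<omega> t)"

definition fisher_info ::
    "('m::finite \<Rightarrow> real poly fract) \<Rightarrow> real poly fract \<Rightarrow> real pmf \<Rightarrow> real^'m^'m" where
  "fisher_info f \<omega> \<xi> = measure_pmf.expectation \<xi> (info_at f \<omega>)"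

definition info_set ::
    "real set \<Rightarrow> ('m::finite \<Rightarrow> real poly fract) \<Rightarrow> real poly fract \<Rightarrow> (real^'m^'m) set" where
  "info_set I f \<omega> = convex hull (info_at f \<omega> ` I)"

definition optimal_design ::
    "(real^'m^'m \<Rightarrow> real) \<Rightarrow> real set \<Rightarrow> ('m::finite \<Rightarrow> real poly fract) \<Rightarrow> real poly fract \<Rightarrow>
     real pmf \<Rightarrow> bool" where
  "optimal_design \<Phi> I f \<omega> \<xi> \<longleftrightarrow>
     design I \<xi> \<and>
     (\<forall>\<xi>'. design I \<xi>' \<longrightarrow> \<Phi> (fisher_info f \<omega> \<xi>') \<le> \<Phi> (fisher_info f \<omega> \<xi>))"


section \<open>Symmetric matrices\<close>

text \<open>
  \<open>sym_mats K\<close> is the space of real symmetric matrices whose rows and columns are indexed by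
  \<open>K\<close>, that is, symmetric matrices of order \<open>card K\<close>.  Matrices of different
  orders live in one type, being padded with zeros outside \<open>K \<times> K\<close>.  On these spaces the inner
  product \<open>\<bullet>\<close> is the Frobenius inner product.  Likewise \<open>coord_space L\<close> is a copy of the
  space of real vectors of length \<open>card L\<close>, where \<open>L\<close> may be empty.
\<close>

definition sym_mats :: "'k set \<Rightarrow> (real^'k^'k::finite) set" where
  "sym_mats K = {A. transpose A = A \<and> (\<forall>a b. a \<notin> K \<or> b \<notin> K \<longrightarrow> A $ a $ b = 0)}"

definition coord_space :: "'l set \<Rightarrow> (real^'l::finite) set" where
  "coord_space L = {u. \<forall>j. j \<notin> L \<longrightarrow> u $ j = 0}"

definition psd_on :: "'k set \<Rightarrow> (real^'k^'k::finite) \<Rightarrow> bool" where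
  "psd_on K A \<longleftrightarrow> A \<in> sym_mats K \<and> (\<forall>x\<in>coord_space K. x \<bullet> (A *v x) \<ge> 0)"

definition pd_on :: "'k set \<Rightarrow> (real^'k^'k::finite) \<Rightarrow> bool" where
  "pd_on K A \<longleftrightarrow> A \<in> sym_mats K \<and> (\<forall>x\<in>coord_space K. x \<noteq> 0 \<longrightarrow> x \<bullet> (A *v x) > 0)"


section \<open>Semidefinite representations\<close>

text \<open>
  The type \<open>'p\<close> indexes the blocks, the \<open>i\<close>-th block has order
  \<open>card (block R i)\<close>, and the auxiliary variable \<open>u\<close> ranges over
  \<open>coord_space (params R)\<close>.
\<close>

record ('m::finite, 'p::finite, 'k::finite, 'l::finite) sd_rep =
  block :: "'p \<Rightarrow> 'k set"
  params :: "'l set"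
  opA :: "'p \<Rightarrow> real^'m^'m \<Rightarrow> real^'k^'k"
  matB :: "'p \<Rightarrow> real^'k^'k"
  opC :: "'p \<Rightarrow> real^'l \<Rightarrow> real^'k^'k"
  matD :: "'p \<Rightarrow> real^'k^'k"

text \<open>
  Only the restrictions of \<open>opA R i\<close> to symmetric matrices and of \<open>opC R i\<close> to
  \<open>coord_space (params R)\<close> are ever used; every linear map on these subspaces extends to the
  whole type.
\<close>

definition sd_rep_wf :: "('m::finite, 'p::finite, 'k::finite, 'l::finite) sd_rep \<Rightarrow> bool" where
  "sd_rep_wf R \<longleftrightarrow>
     (\<forall>i. block R i \<noteq> {} \<and>
        linear (opA R i) \<and> opA R i ` sym_mats UNIV \<subseteq> sym_mats (block R i) \<and>
        linear (opC R i) \<and> opC R i ` coord_space (params R) \<subseteq> sym_mats (block R i) \<and>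
        matB R i \<in> sym_mats (block R i) \<and> matD R i \<in> sym_mats (block R i))"

definition lmi :: "('m::finite, 'p::finite, 'k::finite, 'l::finite) sd_rep \<Rightarrow> 'p \<Rightarrow>
    real^'m^'m \<Rightarrow> real \<Rightarrow> real^'l \<Rightarrow> real^'k^'k" where
  "lmi R i X z u = opA R i X + z *\<^sub>R matB R i + opC R i u + matD R i"

definition sd_represents ::
    "('m::finite, 'p::finite, 'k::finite, 'l::finite) sd_rep \<Rightarrow> (real^'m^'m \<Rightarrow> real) \<Rightarrow> bool" where
  "sd_represents R \<Phi> \<longleftrightarrow> sd_rep_wf R \<and>
     (\<forall>X z. psd_on UNIV X \<longrightarrow>
        (\<Phi> X \<ge> z \<longleftrightarrow> (\<exists>u\<in>coord_space (params R). \<forall>i. psd_on (block R i) (lmi R i X z u))))"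

definition strictly_feasible ::
    "('m::finite, 'p::finite, 'k::finite, 'l::finite) sd_rep \<Rightarrow> (real^'m^'m) set \<Rightarrow> bool" where
  "strictly_feasible R \<M> \<longleftrightarrow>
     (\<exists>X\<in>\<M>. \<exists>z. \<exists>u\<in>coord_space (params R). \<forall>i. pd_on (block R i) (lmi R i X z u))"

text \<open>\<open>\<Phi>\<close> is an admissible criterion, as witnessed by the representation \<open>R\<close>.\<close>

definition admissible_via ::
    "('m::finite, 'p::finite, 'k::finite, 'l::finite) sd_rep \<Rightarrow> (real^'m^'m \<Rightarrow> real) \<Rightarrow>
     real set \<Rightarrow> ('m \<Rightarrow> real poly fract) \<Rightarrow> real poly fract \<Rightarrow> bool" where
  "admissible_via R \<Phi> I f \<omega> \<longleftrightarrow>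
     sd_represents R \<Phi> \<and> strictly_feasible R (info_set I f \<omega>)"


section \<open>The optimisation problem (P)\<close>

text \<open>
  The adjoint of the restriction of \<open>opC R i\<close> to \<open>coord_space (params R)\<close> consists of the
  coordinates in \<open>params R\<close> of \<open>adjoint (opC R i)\<close>.  The equation defining \<open>\<pi>\<close> is
  an identity of rational functions: it is required at every real \<open>t\<close> that is not a zero of
  the common denominator, not only at the points of \<open>I\<close>, so that \<open>\<pi>\<close> is determined by
  \<open>y\<close> and \<open>W\<close> even if \<open>I\<close> is finite.
\<close>

definition P_feasible ::
    "('m::finite, 'p::finite, 'k::finite, 'l::finite) sd_rep \<Rightarrow>
     real set \<Rightarrow> ('m \<Rightarrow> real poly fract) \<Rightarrow> real poly fract \<Rightarrow>
     real \<Rightarrow> ('p \<Rightarrow> real^'k^'k) \<Rightarrow> real poly \<Rightarrow> bool" where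
  "P_feasible R I f \<omega> y W \<pi> \<longleftrightarrow>
     (\<forall>i. psd_on (block R i) (W i)) \<and>
     (\<Sum>i\<in>UNIV. W i \<bullet> matB R i) = -1 \<and>
     (\<forall>j\<in>params R. (\<Sum>i\<in>UNIV. adjoint (opC R i) (W i)) $ j = 0) \<and>
     (\<forall>t. poly (common_den I f \<omega>) t \<noteq> 0 \<longrightarrow>
        poly \<pi> t = poly (common_den I f \<omega>) t *
          (y - (\<Sum>i\<in>UNIV. W i \<bullet> (opA R i (fisher_info f \<omega> (return_pmf t)) + matD R i)))) \<and>
     (\<forall>t\<in>I. poly \<pi> t \<ge> 0)"

definition P_optimal ::
    "('m::finite, 'p::finite, 'k::finite, 'l::finite) sd_rep \<Rightarrow>
     real set \<Rightarrow> ('m \<Rightarrow> real poly fract) \<Rightarrow> real poly fract \<Rightarrow>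
     real \<Rightarrow> ('p \<Rightarrow> real^'k^'k) \<Rightarrow> real poly \<Rightarrow> bool" where
  "P_optimal R I f \<omega> y W \<pi> \<longleftrightarrow>
     P_feasible R I f \<omega> y W \<pi> \<and>
     (\<forall>y' W' \<pi>'. P_feasible R I f \<omega> y' W' \<pi>' \<longrightarrow> y \<le> y')"

end

theory Submission
  imports Defs
begin

text \<open>
  By semidefinite duality, a Lagrange multiplier of the primal problem of maximising \<open>\<Phi>\<close> is
  feasible for (P) with \<open>y\<close> equal to the optimal value, so the optimal \<open>y\<close> is at most this
  value.  Pairing \<open>W\<close> with the linear matrix inequality that certifies the value of an optimal
  design shows, by complementary slackness, that \<open>\<pi>\<close> vanishes on the support of the design.
  The bound then counts the zeros of \<open>\<pi>\<close> in \<open>I\<close>: since \<open>\<pi> \<ge> 0\<close> on \<open>I\<close>, zeros in the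
  interior of an interval have multiplicity at least two, and only endpoints and singletons
  can be simple zeros.
\<close>

text \<open>Two hypotheses of the theorem shape the proof. Semidefinite representability makes each
  set \<open>\<Phi> X \<ge> z\<close> a projection along \<open>u\<close>, and projections of closed
  sets need not be closed; \<open>upper_semicontinuous\<close> supplies the maximiser on the compact
  set of information matrices. Moreover, the lcm of the separate denominators need not clear the
  products: for \<open>f i = \<omega> = 1/t\<close> it is \<open>t^2\<close>, while the product is
  \<open>1/t^3\<close>. \<open>clears_denominators\<close> excludes this and forces the denominator
  of \<open>\<omega>\<close> to be coprime to that of every \<open>f i\<close>. The lcm is then
  \<open>rf_den \<omega> * S\<^sup>2\<close> up to sign, with \<open>S\<close> the lcm of the
  denominators of the \<open>f i\<close>, so every choice of multipliers yields a polynomial of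
  degree at most \<open>deg_bound\<close>. This makes the Lagrange multiplier feasible for (P) and
  also bounds the degree of the given \<open>\<pi>\<close>. The slackness argument is the cycle
  \<open>y \<le> \<Phi> X \<le> G W X \<le> y\<close>, where \<open>G W\<close> is the dual
  functional: multiplier, then pairing with the matrix inequality, then averaging over the
  support.\<close>

no_notation fps_nth (infixl \<open>$\<close> 75)

section \<open>Positive semidefinite matrices\<close>

definition outer :: "real^'k \<Rightarrow> real^'k^'k::finite" where
  "outer v = (\<chi> i j. v $ i * v $ j)"

lemma inner_outer: "outer v \<bullet> Q = v \<bullet> (Q *v v)"
  by (simp add: outer_def inner_vec_def matrix_vector_mult_def sum_distrib_left mult_ac)

lemma outer_mult_vec: "outer v *v x = (v \<bullet> x) *\<^sub>R v"
  by (simp add: outer_def vec_eq_iff inner_vec_def matrix_vector_mult_def sum_distrib_left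
      sum_distrib_right mult_ac)

lemma subspace_coord_space: "subspace (coord_space K)"
  by (auto simp: subspace_def coord_space_def)

lemma subspace_sym_mats: "subspace (sym_mats K)"
  by (auto simp: subspace_def sym_mats_def transpose_def vec_eq_iff)

lemma coord_space_mono: "K \<subseteq> L \<Longrightarrow> coord_space K \<subseteq> coord_space L"
  by (auto simp: coord_space_def)

lemma sym_matD: "A \<in> sym_mats K \<Longrightarrow> A $ i $ j = A $ j $ i"
  by (auto simp: sym_mats_def transpose_def vec_eq_iff)

lemma slope_zero_if_affine_nonneg:
  fixes a b :: real
  assumes "\<And>s. b + 2 * s * a \<ge> 0"
  shows "a = 0"
proof (rule ccontr)
  assume "a \<noteq> 0"
  then have "b + 2 * (- (\<bar>b\<bar> + 1) / a) * a = b - 2 * (\<bar>b\<bar> + 1)" by (simp add: field_simps)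
  with assms[of "- (\<bar>b\<bar> + 1) / a"] have "b - 2 * (\<bar>b\<bar> + 1) \<ge> 0" by metis
  then show False by (simp add: abs_if split: if_splits)
qed

text \<open>One step of symmetric elimination. A zero pivot forces its whole row to vanish; a
  positive pivot splits off a rank-one term and leaves the Schur complement, which is supported off
  \<open>a\<close>.\<close>

lemma psd_on_Diff_pivot:
  fixes W :: "real^'k^'k::finite"
  assumes W: "psd_on K W" and a: "a \<in> K"
  defines "w \<equiv> W $ a"
  shows "w \<in> coord_space K"
    and "W $ a $ a = 0 \<Longrightarrow> psd_on (K - {a}) W"
    and "W $ a $ a \<noteq> 0 \<Longrightarrow> W $ a $ a > 0"
    and "W $ a $ a \<noteq> 0 \<Longrightarrow> psd_on (K - {a}) (W - (1 / W $ a $ a) *\<^sub>R outer w)"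
proof -
  have sym: "W \<in> sym_mats K" and form: "\<And>x. x \<in> coord_space K \<Longrightarrow> x \<bullet> (W *v x) \<ge> 0"
    using W by (auto simp: psd_on_def)
  have e: "axis a 1 \<in> coord_space K" using a by (auto simp: coord_space_def axis_def)
  show w: "w \<in> coord_space K"
    using sym by (auto simp: sym_mats_def coord_space_def w_def)
  have We: "W *v axis a 1 = w"
    by (simp add: vec_eq_iff w_def matrix_vector_mult_basis column_def sym_matD[OF sym])
  have eW: "axis a 1 \<bullet> (W *v x) = w \<bullet> x" for x
    by (simp add: inner_axis' matrix_vector_mul_component w_def)
  have eWe: "axis a 1 \<bullet> w = W $ a $ a"
    by (simp add: inner_axis' w_def)
  have expand: "(x + s *\<^sub>R axis a 1) \<bullet> (W *v (x + s *\<^sub>R axis a 1))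
      = x \<bullet> (W *v x) + 2 * s * (w \<bullet> x) + s\<^sup>2 * W $ a $ a" for x s
    by (simp add: matrix_vector_right_distrib matrix_vector_mult_scaleR We
        inner_add_left inner_add_right eW eWe power2_eq_square inner_commute[of x w] algebra_simps)
  have ge: "x \<bullet> (W *v x) + 2 * s * (w \<bullet> x) + s\<^sup>2 * W $ a $ a \<ge> 0"
    if "x \<in> coord_space K" for x s
    using form[of "x + s *\<^sub>R axis a 1"] subspace_add[OF subspace_coord_space that
        subspace_scale[OF subspace_coord_space e, of s]]
    by (simp add: expand)
  have mono: "coord_space (K - {a}) \<subseteq> coord_space K" by (rule coord_space_mono) auto
  {
    assume 0: "W $ a $ a = 0"
    \<comment> \<open>With pivot 0 the form along \<open>w + s *\<^sub>R axis a 1\<close> is affine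
      in \<open>s\<close> with slope \<open>2 * (w \<bullet> w)\<close>, and it is nonnegative for
      all \<open>s\<close>.\<close>
    have "w \<bullet> w = 0"
      by (rule slope_zero_if_affine_nonneg[of "w \<bullet> (W *v w)"]) (use ge[OF w] 0 in simp)
    then have row: "W $ a $ j = 0" for j by (simp add: w_def)
    then have col: "W $ j $ a = 0" for j using sym_matD[OF sym, of j a] by simp
    have "W \<in> sym_mats (K - {a})" using sym row col by (auto simp: sym_mats_def)
    with form mono show "psd_on (K - {a}) W" by (auto simp: psd_on_def)
  }
  assume nz: "W $ a $ a \<noteq> 0"
  have "W $ a $ a \<ge> 0" using form[OF e] by (simp add: We eWe)
  with nz show pos: "W $ a $ a > 0" by simp
  let ?W = "W - (1 / W $ a $ a) *\<^sub>R outer w"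
  have "?W $ i $ j = 0" if "i \<notin> K - {a} \<or> j \<notin> K - {a}" for i j
  proof -
    have W0: "W $ i $ j = 0" if "i \<notin> K \<or> j \<notin> K" for i j
      using sym that by (auto simp: sym_mats_def)
    have w0: "w $ i = 0" if "i \<notin> K" for i using w that by (auto simp: coord_space_def)
    have "W $ i $ j = 1 / W $ a $ a * (w $ i * w $ j)"
    proof (cases "i = a \<or> j = a")
      case True
      then show ?thesis using nz sym_matD[OF sym, of i a] by (auto simp: w_def)
    next
      case False
      with that have "i \<notin> K \<or> j \<notin> K" by auto
      then show ?thesis using W0[of i j] w0[of i] w0[of j] by auto
    qed
    then show ?thesis by (simp add: outer_def)
  qed
  moreover have "transpose ?W = ?W"
    using sym_matD[OF sym] by (simp add: transpose_def vec_eq_iff outer_def mult.commute)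
  moreover have "x \<bullet> (?W *v x) \<ge> 0" if x: "x \<in> coord_space K" for x
  proof -
    have "x \<bullet> (?W *v x) = x \<bullet> (W *v x) - (w \<bullet> x)\<^sup>2 / W $ a $ a"
      by (simp add: matrix_vector_mult_diff_rdistrib scaleR_matrix_vector_assoc[symmetric]
          outer_mult_vec inner_diff_right inner_commute[of x w] power2_eq_square)
    \<comment> \<open>The chosen \<open>s = - (w \<bullet> x) / W $ a $ a\<close> minimises the
      quadratic in \<open>ge\<close>.\<close>
    also have "\<dots> = x \<bullet> (W *v x) + 2 * (- (w \<bullet> x) / W $ a $ a) * (w \<bullet> x)
        + (- (w \<bullet> x) / W $ a $ a)\<^sup>2 * W $ a $ a"
      using nz by (simp add: power2_eq_square)
    also have "\<dots> \<ge> 0" by (rule ge[OF x])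
    finally show ?thesis .
  qed
  ultimately show "psd_on (K - {a}) ?W"
    using mono unfolding psd_on_def sym_mats_def by blast
qed

text \<open>Repeated elimination writes \<open>W\<close> as a sum of rank-one matrices
  \<open>outer v\<close>; this takes the place of a spectral decomposition.\<close>

lemma psd_on_induct:
  fixes W :: "real^'k^'k::finite"
  assumes "psd_on K W" and "P 0"
    and step: "\<And>W v. P W \<Longrightarrow> v \<in> coord_space K \<Longrightarrow> v \<noteq> 0 \<Longrightarrow> P (W + outer v)"
  shows "P W"
proof -
  have "finite L \<Longrightarrow> L \<subseteq> K \<Longrightarrow> psd_on L W \<Longrightarrow> P W" for L and W :: "real^'k^'k"
  proof (induction L arbitrary: W rule: finite_induct)
    case empty
    then have "W = 0" by (auto simp: psd_on_def sym_mats_def vec_eq_iff)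
    with \<open>P 0\<close> show ?case by simp
  next
    case (insert a L)
    note pivot = psd_on_Diff_pivot[OF insert.prems(2) insertI1]
    have L: "insert a L - {a} = L" using insert.hyps by auto
    show ?case
    proof (cases "W $ a $ a = 0")
      case True
      with pivot(2) L insert show ?thesis by auto
    next
      case False
      let ?v = "(1 / sqrt (W $ a $ a)) *\<^sub>R W $ a"
      have "P (W - (1 / W $ a $ a) *\<^sub>R outer (W $ a))"
        using pivot(4)[OF False] L insert by auto
      moreover have "?v \<in> coord_space K"
        using pivot(1) coord_space_mono[OF insert.prems(1)]
        by (intro subspace_scale[OF subspace_coord_space]) auto
      moreover have "W $ a \<noteq> 0" using False by auto
      moreover have "outer ?v = (1 / W $ a $ a) *\<^sub>R outer (W $ a)"
        using pivot(3)[OF False] by (simp add: outer_def vec_eq_iff field_simps)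
      ultimately show ?thesis
        using step[of "W - (1 / W $ a $ a) *\<^sub>R outer (W $ a)" ?v] pivot(3)[OF False] by simp
    qed
  qed
  from this[of K] assms(1) show ?thesis by simp
qed

lemma psd_on_inner_nonneg:
  assumes "psd_on K W" and "\<And>x. x \<in> coord_space K \<Longrightarrow> x \<bullet> (Q *v x) \<ge> 0"
  shows "W \<bullet> Q \<ge> 0"
  using assms(1) by (rule psd_on_induct) (auto simp: inner_add_left inner_outer assms(2))

lemma psd_on_inner_pos:
  assumes "psd_on K W" and "pd_on K Q" and "W \<noteq> 0"
  shows "W \<bullet> Q > 0"
proof -
  \<comment> \<open>The induction starts at 0, where strict positivity fails, hence the
    disjunction.\<close>
  have "W = 0 \<or> W \<bullet> Q > 0"
    using assms(1)
    by (rule psd_on_induct) (use assms(2) in \<open>auto simp: inner_add_left inner_outer pd_on_def\<close>)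
  with assms(3) show ?thesis by simp
qed

text \<open>
  The test matrices \<open>Q\<close> are not required to be symmetric or supported on \<open>K \<times> K\<close>; this is
  what forces \<open>W\<close> into \<^term>\<open>sym_mats K\<close>.
\<close>

lemma psd_onI_dual:
  fixes W :: "real^'k^'k::finite"
  assumes *: "\<And>Q. (\<And>x. x \<in> coord_space K \<Longrightarrow> x \<bullet> (Q *v x) \<ge> 0) \<Longrightarrow> W \<bullet> Q \<ge> 0"
  shows "psd_on K W"
proof -
  define E where "E i j = (\<chi> a b. if a = i \<and> b = j then 1 else (0 :: real))" for i j :: 'k
  have "(E i j *v x) $ k = ((x $ j) *\<^sub>R axis i 1) $ k" for i j k x
  proof -
    have "(E i j *v x) $ k = (\<Sum>b\<in>UNIV. if b = j then (if k = i then x $ j else 0) else 0)"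
      unfolding matrix_vector_mult_def E_def vec_lambda_beta by (rule sum.cong) auto
    then show ?thesis by (simp add: axis_def)
  qed
  then have E_mult: "E i j *v x = (x $ j) *\<^sub>R axis i 1" for i j x
    by (simp add: vec_eq_iff)
  have E_form: "x \<bullet> (E i j *v x) = x $ i * x $ j" for i j x
    by (simp add: E_mult inner_axis)
  have W_E: "W \<bullet> E i j = W $ i $ j" for i j
  proof -
    have "W $ a \<bullet> E i j $ a = (if a = i then W $ i $ j else 0)" for a
    proof -
      have "W $ a \<bullet> E i j $ a = (\<Sum>b\<in>UNIV. if b = j then (if a = i then W $ a $ j else 0) else 0)"
        unfolding inner_vec_def by (rule sum.cong) (auto simp: E_def)
      then show ?thesis by simp
    qed
    then have "W \<bullet> E i j = (\<Sum>a\<in>UNIV. if a = i then W $ i $ j else 0)"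
      by (simp add: inner_vec_def[of W])
    then show ?thesis by simp
  qed
  \<comment> \<open>If the form of \<open>Q\<close> vanishes on \<open>coord_space K\<close>, both
    \<open>Q\<close> and \<open>- Q\<close> are test matrices. Skew differences
    \<open>E i j - E j i\<close> then give symmetry, and \<open>E i j\<close> with an index outside
    \<open>K\<close> gives the support condition.\<close>
  have zero: "W \<bullet> Q = 0" if "\<And>x. x \<in> coord_space K \<Longrightarrow> x \<bullet> (Q *v x) = 0" for Q
  proof -
    have "(- Q) *v x = - (Q *v x)" for x
      by (simp add: matrix_vector_mult_def vec_eq_iff sum_negf)
    then have "- (W \<bullet> Q) \<ge> 0" using *[of "- Q"] that by simp
    moreover have "W \<bullet> Q \<ge> 0" using *[of Q] that by simp
    ultimately show ?thesis by simp
  qed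
  have sym: "W $ i $ j = W $ j $ i" for i j
    using zero[of "E i j - E j i"]
    by (simp add: matrix_vector_mult_diff_rdistrib inner_diff_right E_form W_E)
  have out: "W $ i $ j = 0" if "i \<notin> K \<or> j \<notin> K" for i j
    using zero[of "E i j"] that by (auto simp: E_form W_E coord_space_def)
  have "x \<bullet> (W *v x) \<ge> 0" for x
  proof -
    have "y \<bullet> (outer x *v y) \<ge> 0" for y
      by (simp add: outer_mult_vec inner_commute[of y x])
    from *[OF this] show ?thesis by (simp add: inner_commute[of W] inner_outer)
  qed
  with sym out show ?thesis
    by (auto simp: psd_on_def sym_mats_def transpose_def vec_eq_iff)
qed

section \<open>Semidefinite duality\<close>

lemma nonneg_if_bounded_ray:
  fixes c d q :: real
  assumes "\<And>s. s \<ge> 0 \<Longrightarrow> c - s * q \<le> d"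
  shows "q \<ge> 0"
proof (rule ccontr)
  assume "\<not> q \<ge> 0"
  then have "(\<bar>d - c\<bar> + 1) / - q * q = - (\<bar>d - c\<bar> + 1)" by (simp add: field_simps)
  moreover have "(\<bar>d - c\<bar> + 1) / - q \<ge> 0" using \<open>\<not> q \<ge> 0\<close> by (intro divide_nonneg_nonneg) auto
  ultimately show False using assms[of "(\<bar>d - c\<bar> + 1) / - q"] by linarith
qed

lemma zero_if_bounded_line:
  fixes c d q :: real
  assumes "\<And>s. c + s * q \<le> d"
  shows "q = 0"
proof -
  have "q \<ge> 0" by (rule nonneg_if_bounded_ray[of c _ d]) (use assms[of "- _"] in simp)
  moreover have "- q \<ge> 0" by (rule nonneg_if_bounded_ray[of c _ d]) (use assms in simp)
  ultimately show ?thesis by simp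
qed

lemma lmi_affine:
  assumes "sd_rep_wf R" and "a + b = 1"
  shows "lmi R i (a *\<^sub>R X + b *\<^sub>R X') (a * z + b * z') (a *\<^sub>R u + b *\<^sub>R u')
    = a *\<^sub>R lmi R i X z u + b *\<^sub>R lmi R i X' z' u'"
proof -
  have A: "linear (opA R i)" and C: "linear (opC R i)" using assms by (auto simp: sd_rep_wf_def)
  have "matD R i = a *\<^sub>R matD R i + b *\<^sub>R matD R i"
    using assms(2) by (simp flip: scaleR_left_distrib)
  then show ?thesis
    by (simp add: lmi_def linear_add[OF A] linear_scale[OF A] linear_add[OF C] linear_scale[OF C]
        algebra_simps)
qed

lemma lmi_in_sym_mats:
  assumes "sd_rep_wf R" and "X \<in> sym_mats UNIV" and "u \<in> coord_space (params R)"
  shows "lmi R i X z u \<in> sym_mats (block R i)"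
  using assms unfolding sd_rep_wf_def lmi_def
  by (intro subspace_add[OF subspace_sym_mats] subspace_scale[OF subspace_sym_mats]) blast+

text \<open>
  No pair \<open>(0, z)\<close> with \<open>z > v\<close> is of the form \<open>(lmi X z u - Q, z)\<close> with \<open>X \<in> M\<close> and \<open>Q\<close>
  positive semidefinite.  A hyperplane separating these convex sets is a dual solution;
  strict feasibility prevents it from being vertical.
\<close>

lemma strong_duality:
  fixes R :: "('m::finite, 'p::finite, 'k::finite, 'l::finite) sd_rep"
  assumes rep: "sd_represents R \<Phi>" and "convex M" and M_psd: "\<And>X. X \<in> M \<Longrightarrow> psd_on UNIV X"
    and "strictly_feasible R M" and bound: "\<And>X. X \<in> M \<Longrightarrow> \<Phi> X \<le> v"
  obtains W where "\<And>i. psd_on (block R i) (W i)" and "(\<Sum>i\<in>UNIV. W i \<bullet> matB R i) = -1"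
    and "\<And>u. u \<in> coord_space (params R) \<Longrightarrow> (\<Sum>i\<in>UNIV. W i \<bullet> opC R i u) = 0"
    and "\<And>X. X \<in> M \<Longrightarrow> (\<Sum>i\<in>UNIV. W i \<bullet> (opA R i X + matD R i)) \<le> v"
proof -
  \<comment> \<open>This cone is larger than the positive semidefinite one, as symmetry and support
    are not imposed. It is the cone of test matrices of \<open>psd_onI_dual\<close>, so the
    multipliers become symmetric by themselves; in the disjointness argument, symmetry of
    \<open>Q\<close> is recovered from \<open>lmi_in_sym_mats\<close>.\<close>
  define N where "N i = {Q :: real^'k^'k. \<forall>x\<in>coord_space (block R i). x \<bullet> (Q *v x) \<ge> 0}" for i
  define L where "L X z u Q = ((\<chi> i. lmi R i X z u - Q i), z)" for X z u and Q :: "'p \<Rightarrow> real^'k^'k"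
  define S where "S = {L X z u Q | X z u Q. X \<in> M \<and> u \<in> coord_space (params R) \<and> (\<forall>i. Q i \<in> N i)}"
  define T where "T = {0 :: real^'k^'k^'p} \<times> {v<..}"
  have wf: "sd_rep_wf R" using rep by (simp add: sd_represents_def)
  have 0: "0 \<in> N i" for i by (simp add: N_def)
  have N_scale: "s *\<^sub>R Q \<in> N i" if "Q \<in> N i" "s \<ge> 0" for Q i s
    using that by (simp add: N_def scaleR_matrix_vector_assoc[symmetric])
  have N_add: "Q + Q' \<in> N i" if "Q \<in> N i" "Q' \<in> N i" for Q Q' i
    using that by (simp add: N_def matrix_vector_mult_add_rdistrib inner_add_right)
  obtain X0 z0 u0 where X0: "X0 \<in> M" and u0: "u0 \<in> coord_space (params R)"
    and pd: "\<And>i. pd_on (block R i) (lmi R i X0 z0 u0)"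
    using assms(4) by (auto simp: strictly_feasible_def)
  have LS: "L X z u Q \<in> S" if "X \<in> M" "u \<in> coord_space (params R)" "\<And>i. Q i \<in> N i" for X z u Q
    using that by (auto simp: S_def)
  have "convex S"
  proof (rule convexI)
    fix p q :: "(real^'k^'k^'p) \<times> real" and a b :: real
    assume "p \<in> S" "q \<in> S" and ab: "0 \<le> a" "0 \<le> b" "a + b = 1"
    then obtain X z u Q X' z' u' Q' where p: "p = L X z u Q" "X \<in> M" "u \<in> coord_space (params R)"
        "\<And>i. Q i \<in> N i"
      and q: "q = L X' z' u' Q'" "X' \<in> M" "u' \<in> coord_space (params R)" "\<And>i. Q' i \<in> N i"
      unfolding S_def by blast
    have "a *\<^sub>R p + b *\<^sub>R q = L (a *\<^sub>R X + b *\<^sub>R X') (a * z + b * z') (a *\<^sub>R u + b *\<^sub>R u')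
        (\<lambda>i. a *\<^sub>R Q i + b *\<^sub>R Q' i)"
      by (simp add: p q L_def lmi_affine[OF wf ab(3)]) (simp add: vec_eq_iff algebra_simps)
    also have "\<dots> \<in> S"
      using p q ab
      by (intro LS convexD[OF \<open>convex M\<close>] subspace_add[OF subspace_coord_space]
          subspace_scale[OF subspace_coord_space] N_add N_scale) auto
    finally show "a *\<^sub>R p + b *\<^sub>R q \<in> S" .
  qed
  moreover have "convex T" by (auto simp: T_def intro!: convex_Times)
  moreover have "S \<noteq> {}" using LS[OF X0 u0, of "\<lambda>_. 0"] 0 by auto
  moreover have "(0, v + 1) \<in> T" by (simp add: T_def)
  moreover have "S \<inter> T = {}"
  proof (rule ccontr)
    assume "S \<inter> T \<noteq> {}"
    then obtain X z u Q where "L X z u Q \<in> T" and X: "X \<in> M" and u: "u \<in> coord_space (params R)"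
      and Q: "\<And>i. Q i \<in> N i"
      unfolding S_def by blast
    then have "z > v" and eq: "\<And>i. lmi R i X z u = Q i"
      by (auto simp: L_def T_def vec_eq_iff)
    have "X \<in> sym_mats UNIV" using M_psd[OF X] by (simp add: psd_on_def)
    then have "psd_on (block R i) (lmi R i X z u)" for i
      using Q[of i] lmi_in_sym_mats[OF wf _ u, of X i z] by (simp add: psd_on_def N_def eq)
    then have "\<Phi> X \<ge> z"
      using rep M_psd[OF X] u by (auto simp: sd_represents_def)
    with bound[OF X] \<open>z > v\<close> show False by simp
  qed
  ultimately obtain c b where "c \<noteq> 0" and Sb: "\<And>p. p \<in> S \<Longrightarrow> c \<bullet> p \<le> b"
    and Tb: "\<And>p. p \<in> T \<Longrightarrow> c \<bullet> p \<ge> b"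
    using separating_hyperplane_sets[of S T] by blast
  obtain a \<tau> where c: "c = (a, \<tau>)" by (cases c)
  have \<tau>b: "b \<le> \<tau> * r" if "r > v" for r
    using Tb[of "(0, r)"] that by (simp add: T_def c)
  have "\<tau> \<ge> 0"
    by (rule nonneg_if_bounded_ray[of "b - \<tau> * (v + 1)" _ 0])
      (use \<tau>b[of "v + 1 + _"] in \<open>simp add: algebra_simps\<close>)
  \<comment> \<open>The levels in \<open>T\<close> lie strictly above \<open>v\<close>; let them
    decrease to \<open>v\<close>.\<close>
  have "b \<le> \<tau> * v"
  proof (rule field_le_epsilon)
    fix e :: real assume "e > 0"
    show "b \<le> \<tau> * v + e"
    proof (cases "\<tau> = 0")
      case True
      then show ?thesis using \<tau>b[of "v + 1"] \<open>e > 0\<close> by simp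
    next
      case False
      then show ?thesis using \<tau>b[of "v + e / \<tau>"] \<open>e > 0\<close> \<open>\<tau> \<ge> 0\<close> by (simp add: algebra_simps)
    qed
  qed
  have main: "(\<Sum>i\<in>UNIV. a $ i \<bullet> lmi R i X z u) - (\<Sum>i\<in>UNIV. a $ i \<bullet> Q i) + \<tau> * z \<le> \<tau> * v"
    if "X \<in> M" "u \<in> coord_space (params R)" "\<And>i. Q i \<in> N i" for X z u Q
    using order_trans[OF Sb[OF LS[OF that]] \<open>b \<le> \<tau> * v\<close>]
    by (simp add: c L_def inner_vec_def[of a] inner_diff_right sum_subtractf)
  have psd: "psd_on (block R i) (a $ i)" for i
  proof (rule psd_onI_dual)
    fix Q assume "\<And>x. x \<in> coord_space (block R i) \<Longrightarrow> x \<bullet> (Q *v x) \<ge> 0"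
    then have Q: "Q \<in> N i" by (simp add: N_def)
    show "a $ i \<bullet> Q \<ge> 0"
    proof (rule nonneg_if_bounded_ray)
      fix s :: real assume s: "s \<ge> 0"
      \<comment> \<open>Moving along a ray of the cone in block \<open>i\<close> alone isolates the
        sign of \<open>a $ i \<bullet> Q\<close>.\<close>
      let ?Q = "\<lambda>j. if j = i then s *\<^sub>R Q else 0"
      have "(\<Sum>j\<in>UNIV. a $ j \<bullet> ?Q j) = (\<Sum>j\<in>UNIV. if j = i then s * (a $ i \<bullet> Q) else 0)"
        by (rule sum.cong) auto
      then show "(\<Sum>i\<in>UNIV. a $ i \<bullet> lmi R i X0 z0 u0) + \<tau> * z0 - s * (a $ i \<bullet> Q) \<le> \<tau> * v"
        using main[OF X0 u0, of ?Q z0] N_scale[OF Q s] 0 by (simp add: algebra_simps)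
    qed
  qed
  have main0: "(\<Sum>i\<in>UNIV. a $ i \<bullet> (opA R i X + matD R i)) + z * ((\<Sum>i\<in>UNIV. a $ i \<bullet> matB R i) + \<tau>)
      + (\<Sum>i\<in>UNIV. a $ i \<bullet> opC R i u) \<le> \<tau> * v"
    if "X \<in> M" "u \<in> coord_space (params R)" for X z u
    using main[OF that, of "\<lambda>_. 0" z] 0
    by (simp add: lmi_def inner_add_right sum.distrib sum_distrib_left algebra_simps)
  \<comment> \<open>\<open>z\<close> ranges over all reals, so its coefficient in a bounded
    expression vanishes. Division by \<open>\<tau>\<close> later turns this into the normalisation
    -1 in (P).\<close>
  have B: "(\<Sum>i\<in>UNIV. a $ i \<bullet> matB R i) + \<tau> = 0"
  proof (rule zero_if_bounded_line)
    show "((\<Sum>i\<in>UNIV. a $ i \<bullet> (opA R i X0 + matD R i)) + (\<Sum>i\<in>UNIV. a $ i \<bullet> opC R i u0))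
        + s * ((\<Sum>i\<in>UNIV. a $ i \<bullet> matB R i) + \<tau>) \<le> \<tau> * v" for s
      using main0[OF X0 u0, of s] by simp
  qed
  have C: "(\<Sum>i\<in>UNIV. a $ i \<bullet> opC R i u) = 0" if u: "u \<in> coord_space (params R)" for u
  proof (rule zero_if_bounded_line)
    fix s
    have "opC R i (s *\<^sub>R u) = s *\<^sub>R opC R i u" for i
      using wf by (simp add: sd_rep_wf_def linear_scale)
    then show "(\<Sum>i\<in>UNIV. a $ i \<bullet> (opA R i X0 + matD R i)) + s * (\<Sum>i\<in>UNIV. a $ i \<bullet> opC R i u) \<le> \<tau> * v"
      using main0[OF X0 subspace_scale[OF subspace_coord_space u, of s], of 0]
      by (simp add: sum_distrib_left)
  qed
  have A: "(\<Sum>i\<in>UNIV. a $ i \<bullet> (opA R i X + matD R i)) \<le> \<tau> * v" if "X \<in> M" for X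
    using main0[OF that u0, of 0] C[OF u0] by simp
  \<comment> \<open>At a strictly feasible point a vertical hyperplane would give \<open>a\<close> a
    nonpositive pairing with positive definite blocks, so \<open>a = 0\<close> and the whole normal
    vector is zero.\<close>
  have "\<tau> \<noteq> 0"
  proof
    assume \<tau>: "\<tau> = 0"
    have nonneg: "a $ i \<bullet> lmi R i X0 z0 u0 \<ge> 0" for i
      using psd_on_inner_pos[OF psd pd] by (cases "a $ i = 0") (auto intro: less_imp_le)
    have "(\<Sum>i\<in>UNIV. a $ i \<bullet> lmi R i X0 z0 u0) \<le> 0"
      using main[OF X0 u0, of "\<lambda>_. 0" z0] 0 \<tau> by simp
    with nonneg have "(\<Sum>i\<in>UNIV. a $ i \<bullet> lmi R i X0 z0 u0) = 0"
      by (intro order_antisym sum_nonneg) auto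
    then have "a $ i \<bullet> lmi R i X0 z0 u0 = 0" for i
      using sum_nonneg_eq_0_iff[of UNIV "\<lambda>i. a $ i \<bullet> lmi R i X0 z0 u0"] nonneg by simp
    then have "a $ i = 0" for i
      using psd_on_inner_pos[OF psd pd, of i] by auto
    then show False using \<open>c \<noteq> 0\<close> \<tau> by (simp add: c vec_eq_iff zero_prod_def)
  qed
  with \<open>\<tau> \<ge> 0\<close> have \<tau>: "\<tau> > 0" by simp
  let ?W = "\<lambda>i. (1 / \<tau>) *\<^sub>R a $ i"
  have scale: "(\<Sum>i\<in>UNIV. ?W i \<bullet> g i) = (\<Sum>i\<in>UNIV. a $ i \<bullet> g i) / \<tau>" for g
    by (simp add: sum_divide_distrib)
  show thesis
  proof (rule that[of ?W])
    show "psd_on (block R i) (?W i)" for i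
      using psd[of i] \<tau> subspace_scale[OF subspace_sym_mats, of "a $ i" "block R i" "1 / \<tau>"]
      by (simp add: psd_on_def scaleR_matrix_vector_assoc[symmetric])
    show "(\<Sum>i\<in>UNIV. ?W i \<bullet> matB R i) = -1"
      unfolding scale using B \<tau> by (simp add: field_simps)
    show "(\<Sum>i\<in>UNIV. ?W i \<bullet> opC R i u) = 0" if "u \<in> coord_space (params R)" for u
      unfolding scale using C[OF that] by simp
    show "(\<Sum>i\<in>UNIV. ?W i \<bullet> (opA R i X + matD R i)) \<le> v" if "X \<in> M" for X
      unfolding scale using A[OF that] \<tau> by (simp add: field_simps)
  qed
qed

section \<open>Zeros of nonnegative polynomials\<close>

text \<open>An interior zero is a local minimum, so the derivative vanishes there as well.\<close>

lemma two_le_order_if_nonneg: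
  fixes p :: "real poly"
  assumes "p \<noteq> 0" and "poly p t = 0" and "a < t" "t < b"
    and nonneg: "\<And>x. x \<in> {a..b} \<Longrightarrow> poly p x \<ge> 0"
  shows "order t p \<ge> 2"
proof -
  let ?d = "min (t - a) (b - t)"
  have "poly (pderiv p) t = 0"
    by (rule DERIV_local_min[OF poly_DERIV, of ?d]) (use assms in \<open>auto intro!: nonneg\<close>)
  moreover have "pderiv p \<noteq> 0"
  proof
    assume "pderiv p = 0"
    then obtain c where "p = [:c:]" using pderiv_iszero by blast
    with assms(1,2) show False by simp
  qed
  ultimately have "order t (pderiv p) \<ge> 1" by (metis One_nat_def Suc_leI gr0I order_root)
  then show ?thesis using order_pderiv[OF assms(1,2)] by simp
qed

lemma card_roots_bound:
  fixes p :: "real poly"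
  assumes "finite \<J>" and J: "\<And>J. J \<in> \<J> \<Longrightarrow> \<exists>a b. a \<le> b \<and> J = {a..b}"
    and "p \<noteq> 0" and nonneg: "\<And>t. t \<in> \<Union>\<J> \<Longrightarrow> poly p t \<ge> 0"
    and Z: "Z \<subseteq> {t \<in> \<Union>\<J>. poly p t = 0}"
  shows "2 * card Z \<le> card {J \<in> \<J>. \<exists>a. J = {a}} + 2 * card {J \<in> \<J>. \<exists>a b. a < b \<and> J = {a..b}}
    + degree p"
proof -
  define J1 where "J1 = {J \<in> \<J>. \<exists>a. J = {a}}"
  define J2 where "J2 = {J \<in> \<J>. \<exists>a b. a < b \<and> J = {a..b}}"
  \<comment> \<open>A singleton contributes one point and a proper interval two, which is the source
    of \<open>k1 + 2 * k2\<close>.\<close>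
  define E where "E = Inf ` J1 \<union> Inf ` J2 \<union> Sup ` J2"
  have "finite J1" "finite J2" using \<open>finite \<J>\<close> by (simp_all add: J1_def J2_def)
  then have "finite E" by (simp add: E_def)
  have "card E \<le> card J1 + 2 * card J2"
    unfolding E_def
    using \<open>finite J1\<close> \<open>finite J2\<close> card_Un_le[of "Inf ` J1 \<union> Inf ` J2" "Sup ` J2"] card_Un_le[of "Inf ` J1" "Inf ` J2"]
      card_image_le[of J1 Inf] card_image_le[of J2 Inf] card_image_le[of J2 Sup]
    by simp
  have roots: "finite {t. poly p t = 0}" using \<open>p \<noteq> 0\<close> by (rule poly_roots_finite)
  then have "finite Z" using Z by (auto intro: finite_subset)
  have order: "order t p \<ge> (if t \<in> E then 1 else 2)" if t: "t \<in> Z" for t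
  proof (cases "t \<in> E")
    case True
    then show ?thesis using t Z order_root[of p t] \<open>p \<noteq> 0\<close> by (auto simp: Suc_le_eq)
  next
    case False
    from t Z obtain J where "J \<in> \<J>" "t \<in> J" by auto
    then obtain a b where ab: "a \<le> b" "J = {a..b}" "t \<in> {a..b}" using J by blast
    have "a \<noteq> b"
    proof
      assume "a = b"
      with ab \<open>J \<in> \<J>\<close> have "J \<in> J1" "Inf J = t" by (auto simp: J1_def)
      with False show False by (auto simp: E_def)
    qed
    with ab \<open>J \<in> \<J>\<close> have "a < b" and "J \<in> J2" "Inf J = a" "Sup J = b" by (auto simp: J2_def)
    with False have "t \<noteq> a" "t \<noteq> b" by (auto simp: E_def)
    with ab have "a < t" "t < b" by auto
    moreover have "poly p x \<ge> 0" if "x \<in> {a..b}" for x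
      using nonneg[OF UnionI[OF \<open>J \<in> \<J>\<close>]] that ab by blast
    ultimately show ?thesis
      using two_le_order_if_nonneg[OF \<open>p \<noteq> 0\<close>, of t a b] t Z False by auto
  qed
  \<comment> \<open>Each zero is charged 2 units. Zeros off \<open>E\<close> pay both from their
    multiplicity; zeros in \<open>E\<close> pay one from it and one from the cardinality of
    \<open>E\<close>.\<close>
  have "2 * card Z = (\<Sum>t\<in>Z. (if t \<in> E then 1 else 2) + (if t \<in> E then 1 else 0))"
  proof -
    have "2 * card Z = (\<Sum>t\<in>Z. 2)" by simp
    also have "\<dots> = (\<Sum>t\<in>Z. (if t \<in> E then 1 else 2) + (if t \<in> E then 1 else 0))"
      by (rule sum.cong) auto
    finally show ?thesis .
  qed
  also have "\<dots> = (\<Sum>t\<in>Z. if t \<in> E then 1 else 2) + card (Z \<inter> E)"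
    using \<open>finite Z\<close> by (simp add: sum.distrib sum.If_cases Int_def)
  also have "\<dots> \<le> (\<Sum>t\<in>Z. order t p) + card (Z \<inter> E)"
    using order by (intro add_right_mono sum_mono)
  also have "(\<Sum>t\<in>Z. order t p) \<le> (\<Sum>t | poly p t = 0. order t p)"
    using Z roots by (intro sum_mono2) auto
  also have "\<dots> \<le> degree p" using \<open>p \<noteq> 0\<close> by (rule sum_order_le_degree)
  also have "card (Z \<inter> E) \<le> card J1 + 2 * card J2"
    using card_mono[OF \<open>finite E\<close>, of "Z \<inter> E"] \<open>card E \<le> _\<close> by simp
  finally show ?thesis by (simp add: J1_def J2_def)
qed

section \<open>The common denominator\<close>

text \<open>Powers commute with gcd and with the normalised product, and lcm is determined by these
  two once the gcd is cancelled. It is needed to pull the square out of the lcm of the squared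
  denominators.\<close>

lemma Lcm_power:
  fixes A :: "'a::{semiring_Gcd, semiring_gcd_mult_normalize} set"
  assumes "finite A"
  shows "Lcm ((\<lambda>x. x ^ n) ` A) = Lcm A ^ n"
proof -
  have lcm_power: "lcm (a ^ n) (b ^ n) = lcm a b ^ n" for a b :: 'a
  proof (cases "gcd a b = 0")
    case True
    then show ?thesis by (cases "n = 0") (simp_all add: power_0_left)
  next
    case False
    have "gcd a b ^ n * lcm (a ^ n) (b ^ n) = gcd a b ^ n * lcm a b ^ n"
      using gcd_mult_lcm[of "a ^ n" "b ^ n"]
      by (simp add: normalize_power flip: power_mult_distrib)
    with False show ?thesis by (metis mult_left_cancel power_not_zero)
  qed
  from assms show ?thesis by induction (simp_all add: lcm_power)
qed

lemma rf_den_nonzero [simp]: "rf_den r \<noteq> 0"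
  by (simp add: rf_den_def)

lemma rf_coprime: "coprime (rf_num r) (rf_den r)"
  by (simp add: rf_num_def rf_den_def coprime_quot_of_fract)

lemma Fract_rf: "Fraction_Field.Fract (rf_num r) (rf_den r) = r"
  by (simp add: rf_num_def rf_den_def)

lemma normalize_rf_den [simp]: "normalize (rf_den r) = rf_den r"
  by (simp add: rf_den_def normalize_snd_quot_of_fract)

text \<open>Powers of a coprime pair stay coprime and powers of a monic denominator stay monic, so
  nothing has to be reduced.\<close>

lemma rf_den_power: "rf_den (r ^ n) = rf_den r ^ n"
proof -
  have "r ^ n = Fraction_Field.Fract (rf_num r ^ n) (rf_den r ^ n)"
    by (induction n) (simp_all add: One_fract_def, metis Fract_rf mult_fract)
  then have "r ^ n = quot_to_fract (rf_num r ^ n, rf_den r ^ n)"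
    by (simp add: quot_to_fract_def)
  moreover have "(rf_num r ^ n, rf_den r ^ n) \<in> normalized_fracts"
    using rf_coprime[of r]
    by (simp add: normalized_fracts_def unit_factor_power rf_den_def unit_factor_snd_quot_of_fract)
  ultimately show ?thesis by (simp add: rf_den_def quot_of_fract_quot_to_fract')
qed

text \<open>Used for a fraction \<open>a / b\<close> that need not be in lowest terms: if
  \<open>L\<close> clears the reduced denominator, then \<open>a * L / b\<close> is a
  polynomial.\<close>

lemma dvd_mult_if_rf_den_dvd:
  assumes "rf_den (Fraction_Field.Fract a b) dvd L" and "b \<noteq> 0"
  shows "b dvd a * L"
proof -
  let ?r = "Fraction_Field.Fract a b"
  from assms(1) obtain k where k: "L = rf_den ?r * k" by (rule dvdE)
  have "rf_num ?r * b = a * rf_den ?r"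
    using Fract_rf[of ?r] assms(2) by (simp add: eq_fract)
  then have "a * L = b * (rf_num ?r * k)" by (simp add: k algebra_simps)
  then show ?thesis by simp
qed

lemma multiplicity_Lcm_le:
  fixes A :: "real poly set"
  assumes "finite A" and "0 \<notin> A" and "prime p" and "\<And>x. x \<in> A \<Longrightarrow> multiplicity p x \<le> n"
  shows "multiplicity p (Lcm A) \<le> n"
  using assms
proof (induction A rule: finite_induct)
  case empty
  then show ?case by simp
next
  case (insert a A)
  then show ?case by (simp add: multiplicity_lcm Lcm_0_iff)
qed

lemma common_den_eq_or:
  "common_den I f \<omega> = Lcm (insert (rf_den \<omega>) (range (\<lambda>i. rf_den (f i) ^ 2))) \<or>
   common_den I f \<omega> = - Lcm (insert (rf_den \<omega>) (range (\<lambda>i. rf_den (f i) ^ 2)))"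
  by (simp add: common_den_def Let_def rf_den_power)

text \<open>
  At a common prime factor \<open>p\<close>, for the \<open>f i\<close> whose denominator has the highest multiplicity
  \<open>b\<close>, the denominator of \<open>(f i)\<^sup>2 * \<omega>\<close> has multiplicity \<open>a + 2 * b\<close>, but the common
  denominator only \<open>max a (2 * b)\<close>.
\<close>

lemma coprime_rf_den_if_clears:
  fixes f :: "'m::finite \<Rightarrow> real poly fract"
  assumes clears: "\<And>i. rf_den ((f i)\<^sup>2 * \<omega>) dvd common_den I f \<omega>"
  shows "coprime (rf_den \<omega>) (rf_den (f j))"
proof (rule ccontr)
  let ?L = "Lcm (insert (rf_den \<omega>) (range (\<lambda>i. rf_den (f i) ^ 2)))"
  assume "\<not> coprime (rf_den \<omega>) (rf_den (f j))"
  then have "\<not> is_unit (gcd (rf_den \<omega>) (rf_den (f j)))" by (simp add: coprime_iff_gcd_eq_1)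
  then obtain p where p: "p dvd gcd (rf_den \<omega>) (rf_den (f j))" "prime p"
    using prime_divisor_exists[of "gcd (rf_den \<omega>) (rf_den (f j))"] by auto
  define m where "m i = multiplicity p (rf_den (f i))" for i
  define a where "a = multiplicity p (rf_den \<omega>)"
  have el: "prime_elem p" "\<not> is_unit p" using p(2) by auto
  have pos: "multiplicity p x > 0" if "p dvd x" "x \<noteq> 0" for x
    using that el by (simp add: multiplicity_gt_zero_iff)
  have "a > 0" "m j > 0" using p(1) by (simp_all add: a_def m_def pos)
  define i where "i = (SOME i. m i = Max (range m))"
  have "Max (range m) \<in> range m" by (rule Max_in) auto
  then have "\<exists>i. m i = Max (range m)" by (metis imageE)
  then have i: "m i = Max (range m)" unfolding i_def by (rule someI_ex)
  then have max: "m k \<le> m i" for k by simp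
  with \<open>m j > 0\<close> have "m i > 0" by (metis gr0I leD)
  then have "p dvd rf_den (f i)"
    using not_dvd_imp_multiplicity_0[of p "rf_den (f i)"] by (auto simp: m_def)
  \<comment> \<open>Both fractions are in lowest terms and \<open>p\<close> divides both
    denominators, so no power of \<open>p\<close> cancels in
    \<open>(f i)\<^sup>2 * \<omega>\<close>.\<close>
  then have "\<not> p dvd rf_num (f i)"
    using coprime_common_divisor[OF rf_coprime[of "f i"]] el(2) by blast
  moreover have "\<not> p dvd rf_num \<omega>"
    using coprime_common_divisor[OF rf_coprime[of \<omega>]] el(2) p(1) by auto
  ultimately have "\<not> p dvd rf_num (f i) ^ 2 * rf_num \<omega>"
    using el(1) by (simp add: prime_elem_dvd_mult_iff prime_elem_dvd_power_iff)
  with p(2) have "coprime p (rf_num (f i) ^ 2 * rf_num \<omega>)" by (rule prime_imp_coprime)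
  then have cop: "coprime (p ^ n) (rf_num (f i) ^ 2 * rf_num \<omega>)" for n
    by (simp only: coprime_power_left_iff simp_thms)
  have sq: "(f i)\<^sup>2 * \<omega> = Fraction_Field.Fract (rf_num (f i) ^ 2 * rf_num \<omega>) (rf_den (f i) ^ 2 * rf_den \<omega>)"
    using mult_fract[of "rf_num (f i)" "rf_den (f i)" "rf_num (f i)" "rf_den (f i)"]
      mult_fract[of "rf_num (f i) ^ 2" "rf_den (f i) ^ 2" "rf_num \<omega>" "rf_den \<omega>"]
    by (simp only: Fract_rf power2_eq_square)
  have "rf_den ((f i)\<^sup>2 * \<omega>) dvd ?L"
    using common_den_eq_or[of I f \<omega>]
  proof
    assume "common_den I f \<omega> = ?L"
    with clears[of i] show ?thesis by (simp only:)
  next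
    assume "common_den I f \<omega> = - ?L"
    with clears[of i] show ?thesis by (simp only: dvd_minus_iff)
  qed
  then have "rf_den (f i) ^ 2 * rf_den \<omega> dvd rf_num (f i) ^ 2 * rf_num \<omega> * ?L"
    unfolding sq by (rule dvd_mult_if_rf_den_dvd) simp
  moreover have "p ^ (2 * m i + a) dvd rf_den (f i) ^ 2 * rf_den \<omega>"
    unfolding power_add power_mult mult.commute[of 2] m_def a_def
    by (intro mult_dvd_mono dvd_power_same multiplicity_dvd)
  ultimately have "p ^ (2 * m i + a) dvd rf_num (f i) ^ 2 * rf_num \<omega> * ?L"
    by (rule dvd_trans[rotated])
  then have "p ^ (2 * m i + a) dvd ?L"
    by (rule iffD1[OF coprime_dvd_mult_right_iff[OF cop]])
  moreover have "?L \<noteq> 0" by (subst Lcm_0_iff) auto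
  ultimately have "2 * m i + a \<le> multiplicity p ?L"
    using el(2) by (intro multiplicity_geI) auto
  also have "\<dots> \<le> max a (2 * m i)"
  proof (rule multiplicity_Lcm_le)
    show "multiplicity p x \<le> max a (2 * m i)"
      if "x \<in> insert (rf_den \<omega>) (range (\<lambda>i. rf_den (f i) ^ 2))" for x
      using that
    proof
      assume "x \<in> range (\<lambda>i. rf_den (f i) ^ 2)"
      then obtain k where "x = rf_den (f k) ^ 2" by blast
      then have "multiplicity p x = 2 * m k"
        using el(1) by (simp add: m_def prime_elem_multiplicity_power_distrib)
      with max[of k] show ?thesis by simp
    qed (simp add: a_def)
  qed (use p(2) in auto)
  finally show False using \<open>a > 0\<close> \<open>m i > 0\<close> by simp
qed

text \<open>Two coprime representations of one fraction have denominators dividing each other, hence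
  differ by a nonzero constant \<open>c\<close>; its sign is the sign of the monic denominator on
  \<open>I\<close>.\<close>

lemma rf_num_den_pos_onE:
  assumes "rf_num_den_pos_on I \<omega>"
  obtains c where "c \<noteq> 0" and "\<And>t. t \<in> I \<Longrightarrow> c * poly (rf_den \<omega>) t > 0"
    and "\<And>t. t \<in> I \<Longrightarrow> c * poly (rf_num \<omega>) t > 0"
proof -
  from assms obtain p q where pq: "coprime p q" "q \<noteq> 0" "\<omega> = Fraction_Field.Fract p q"
    and pos: "\<And>t. t \<in> I \<Longrightarrow> poly p t > 0 \<and> poly q t > 0"
    by (auto simp: rf_num_den_pos_on_def)
  have eq: "rf_num \<omega> * q = p * rf_den \<omega>"
    using Fract_rf[of \<omega>] pq by (simp add: eq_fract)
  have "q dvd rf_den \<omega>"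
    using pq(1) eq by (metis coprime_commute coprime_dvd_mult_right_iff dvd_triv_right)
  then obtain k where k: "rf_den \<omega> = q * k" by (rule dvdE)
  have "rf_den \<omega> dvd q"
    using eq rf_coprime[of \<omega>] by (metis coprime_commute coprime_dvd_mult_right_iff dvd_triv_right)
  then obtain u where u: "q = rf_den \<omega> * u" by (rule dvdE)
  have "q * (k * u) = q * 1" using k u by (metis mult.assoc mult_1_right)
  then have "k * u = 1" by (rule iffD1[OF mult_left_cancel[OF pq(2)]])
  then have "is_unit u" by (metis dvd_triv_right)
  then obtain c where "u = [:c:]" "is_unit c" by (auto simp: is_unit_poly_iff)
  with u have c: "c \<noteq> 0" "q = smult c (rf_den \<omega>)" by auto
  have "p * rf_den \<omega> = smult c (rf_num \<omega>) * rf_den \<omega>"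
    unfolding eq[symmetric] c(2) by (simp add: mult.commute)
  then have "p = smult c (rf_num \<omega>)"
    by (rule iffD1[OF mult_right_cancel[OF rf_den_nonzero]])
  with c pos show thesis by (intro that[of c]) (use c(2) in \<open>auto simp flip: poly_smult\<close>)
qed

locale rational_model =
  fixes I :: "real set" and f :: "'m::finite \<Rightarrow> real poly fract" and \<omega> :: "real poly fract"
  assumes finite_on: "\<And>i. rf_finite_on I (f i)"
    and weight_pos: "rf_num_den_pos_on I \<omega>"
    and clears: "\<And>i. rf_den ((f i)\<^sup>2 * \<omega>) dvd common_den I f \<omega>"
begin

definition S :: "real poly" where "S = Lcm (range (\<lambda>i. rf_den (f i)))"

lemma S_nonzero [simp]: "S \<noteq> 0"
  unfolding S_def by (subst Lcm_0_iff) auto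

lemma rf_den_dvd_S: "rf_den (f i) dvd S"
  unfolding S_def by (intro dvd_Lcm rangeI)

text \<open>Coprimality of the denominator of \<open>\<omega>\<close> to all those of the
  \<open>f i\<close> turns the lcm into a product.\<close>

lemma Lcm_den: "Lcm (insert (rf_den \<omega>) (range (\<lambda>i. rf_den (f i) ^ 2))) = rf_den \<omega> * S\<^sup>2"
proof -
  have "Lcm (range (\<lambda>i. rf_den (f i) ^ 2)) = S\<^sup>2"
    unfolding S_def by (subst Lcm_power[symmetric]) (simp_all add: image_image)
  moreover have "S dvd (\<Prod>i\<in>UNIV. rf_den (f i))"
    unfolding S_def by (intro Lcm_least) (auto intro: dvd_prodI)
  then have "coprime (rf_den \<omega>) S"
    using coprime_rf_den_if_clears[OF clears]
    by (meson coprime_divisors dvd_refl prod_coprime_right)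
  ultimately show ?thesis
    by (simp add: lcm_coprime normalize_mult normalize_power S_def)
qed

lemma common_den_cases:
  obtains \<sigma> where "\<sigma> \<noteq> 0" and "common_den I f \<omega> = smult \<sigma> (rf_den \<omega> * S\<^sup>2)"
proof -
  have "common_den I f \<omega> = smult 1 (rf_den \<omega> * S\<^sup>2) \<or> common_den I f \<omega> = smult (- 1) (rf_den \<omega> * S\<^sup>2)"
    using common_den_eq_or[of I f \<omega>] unfolding Lcm_den by simp
  with that show thesis by (metis one_neq_zero zero_neq_neg_one)
qed

lemma degree_common_den: "degree (common_den I f \<omega>) = degree (rf_den \<omega>) + 2 * degree S"
  by (rule common_den_cases) (simp add: degree_mult_eq degree_power_eq)

lemma S_on: "poly S t \<noteq> 0" if "t \<in> I"
proof -
  have "S dvd (\<Prod>i\<in>UNIV. rf_den (f i))"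
    unfolding S_def by (intro Lcm_least) (auto intro: dvd_prodI)
  moreover have "poly (\<Prod>i\<in>UNIV. rf_den (f i)) t \<noteq> 0"
    using finite_on that by (simp add: poly_prod rf_finite_on_def)
  ultimately show ?thesis by (metis dvd_trans poly_eq_0_iff_dvd)
qed

text \<open>On \<open>I\<close> the lcm has the constant sign of \<open>rf_den \<omega>\<close>,
  since the other factor is the square of a nonzero number; the switch in \<open>common_den\<close>
  makes this sign positive. Hence \<open>\<pi> \<ge> 0\<close> on \<open>I\<close> is equivalent to
  the undivided dual inequality.\<close>

lemma common_den_pos:
  assumes "t \<in> I"
  shows "poly (common_den I f \<omega>) t > 0"
proof -
  let ?L = "Lcm (insert (rf_den \<omega>) (range (\<lambda>i. rf_den (f i) ^ 2)))"
  obtain c where c: "c \<noteq> 0" "\<And>t. t \<in> I \<Longrightarrow> c * poly (rf_den \<omega>) t > 0"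
    using rf_num_den_pos_onE[OF weight_pos] by metis
  have L: "c * poly ?L t > 0" if "t \<in> I" for t
  proof -
    have "c * poly ?L t = (c * poly (rf_den \<omega>) t) * (poly S t)\<^sup>2"
      unfolding Lcm_den by simp
    also have "\<dots> > 0"
      using c(2)[OF that] by (rule mult_pos_pos) (use S_on[OF that] in simp)
    finally show ?thesis .
  qed
  show ?thesis
  proof (cases "c > 0")
    case True
    then have "x > 0" if "c * x > 0" for x
      using that by (simp add: zero_less_mult_iff)
    then have pos: "poly ?L t > 0" using L[OF assms] by blast
    then have "\<not> (\<forall>t\<in>I. poly ?L t < 0)" using assms less_asym by blast
    then have "common_den I f \<omega> = ?L"
      unfolding common_den_def Let_def rf_den_power by (rule if_not_P)
    with pos show ?thesis by simp
  next
    case False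
    then have "x < 0" if "c * x > 0" for x
      using that by (simp add: zero_less_mult_iff)
    then have neg: "\<forall>t\<in>I. poly ?L t < 0" using L by blast
    then have "poly (- ?L) t > 0" using assms by (simp only: poly_minus neg_0_less_iff_less)
    moreover have "common_den I f \<omega> = - ?L"
      unfolding common_den_def Let_def rf_den_power using neg by (rule if_P)
    ultimately show ?thesis by simp
  qed
qed

lemma rf_eval_weight_pos: "rf_eval \<omega> t > 0" if "t \<in> I"
proof (rule rf_num_den_pos_onE[OF weight_pos])
  fix c assume "c \<noteq> 0" and pos: "\<And>t. t \<in> I \<Longrightarrow> c * poly (rf_den \<omega>) t > 0"
    "\<And>t. t \<in> I \<Longrightarrow> c * poly (rf_num \<omega>) t > 0"
  have "(c * poly (rf_num \<omega>) t) / (c * poly (rf_den \<omega>) t) > 0"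
    using pos[OF that] by (intro divide_pos_pos)
  with \<open>c \<noteq> 0\<close> show ?thesis by (simp add: rf_eval_def)
qed

text \<open>Writing \<open>f i = g i / S\<close>, the entries of the information matrix times the
  common denominator are constant multiples of \<open>rf_num \<omega> * g i * g j\<close>. With
  \<open>\<mu>\<close> the largest degree difference, \<open>g i\<close> has degree at most
  \<open>\<mu> + degree S\<close>, which gives
  \<open>degree L + deg_diff \<omega> + 2 * \<mu>\<close> for these terms; the positive part in
  \<open>deg_bound\<close> accounts for the remaining term, a constant times
  \<open>L\<close>.\<close>

lemma dual_poly:
  fixes c :: real and a :: "real^'m^'m"
  obtains p where "int (degree p) \<le> deg_bound I f \<omega>"
    and "\<And>t. poly (common_den I f \<omega>) t \<noteq> 0 \<Longrightarrow>
      poly p t = poly (common_den I f \<omega>) t * (c - a \<bullet> info_at f \<omega> t)"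
proof -
  obtain \<sigma> where \<sigma>: "\<sigma> \<noteq> 0" and L: "common_den I f \<omega> = smult \<sigma> (rf_den \<omega> * S\<^sup>2)"
    by (rule common_den_cases)
  define g where "g i = rf_num (f i) * (S div rf_den (f i))" for i
  define p where "p = smult c (common_den I f \<omega>)
    - (\<Sum>i\<in>UNIV. \<Sum>j\<in>UNIV. smult (\<sigma> * a $ i $ j) (rf_num \<omega> * (g i * g j)))"
  define \<mu> where "\<mu> = Max (range (\<lambda>i. deg_diff (f i)))"
  have S_eq: "rf_den (f i) * (S div rf_den (f i)) = S" for i
    using rf_den_dvd_S by simp
  have deg_g: "int (degree (g i)) \<le> \<mu> + int (degree S)" for i
  proof -
    have "S div rf_den (f i) \<noteq> 0" using S_eq[of i] by auto
    then have "degree S = degree (rf_den (f i)) + degree (S div rf_den (f i))"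
      using degree_mult_eq[of "rf_den (f i)" "S div rf_den (f i)"] by (simp add: S_eq)
    moreover have "degree (g i) \<le> degree (rf_num (f i)) + degree (S div rf_den (f i))"
      unfolding g_def by (rule degree_mult_le)
    moreover have "deg_diff (f i) \<le> \<mu>" by (simp add: \<mu>_def)
    ultimately show ?thesis by (simp add: deg_diff_def)
  qed
  have bound: "deg_bound I f \<omega> = int (degree (common_den I f \<omega>)) + max 0 (deg_diff \<omega> + 2 * \<mu>)"
    by (simp add: deg_bound_def \<mu>_def)
  have deg_ij: "int (degree (smult (\<sigma> * a $ i $ j) (rf_num \<omega> * (g i * g j)))) \<le> deg_bound I f \<omega>" for i j
  proof -
    have "int (degree (smult (\<sigma> * a $ i $ j) (rf_num \<omega> * (g i * g j))))
        \<le> int (degree (rf_num \<omega>)) + (int (degree (g i)) + int (degree (g j)))"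
      using degree_smult_le[of "\<sigma> * a $ i $ j" "rf_num \<omega> * (g i * g j)"]
        degree_mult_le[of "rf_num \<omega>" "g i * g j"] degree_mult_le[of "g i" "g j"]
      by linarith
    then show ?thesis
      using deg_g[of i] deg_g[of j] unfolding bound degree_common_den deg_diff_def[of \<omega>] by simp
  qed
  have "degree p \<le> nat (deg_bound I f \<omega>)"
    unfolding p_def
  proof (intro degree_diff_le degree_sum_le)
    show "degree (smult c (common_den I f \<omega>)) \<le> nat (deg_bound I f \<omega>)"
      using degree_smult_le[of c "common_den I f \<omega>"] unfolding bound by linarith
    show "degree (smult (\<sigma> * a $ i $ j) (rf_num \<omega> * (g i * g j))) \<le> nat (deg_bound I f \<omega>)" for i j
      using deg_ij[of i j] by linarith
  qed auto
  moreover have "deg_bound I f \<omega> \<ge> 0" by (simp add: deg_bound_def)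
  ultimately have "int (degree p) \<le> deg_bound I f \<omega>" by linarith
  moreover have "poly p t = poly (common_den I f \<omega>) t * (c - a \<bullet> info_at f \<omega> t)"
    if "poly (common_den I f \<omega>) t \<noteq> 0" for t
  proof -
    from that have nz: "poly (rf_den \<omega>) t \<noteq> 0" "poly S t \<noteq> 0" by (auto simp: L)
    have eval_f: "rf_eval (f i) t = poly (g i) t / poly S t" for i
    proof -
      have "poly S t = poly (rf_den (f i)) t * poly (S div rf_den (f i)) t"
        by (metis S_eq poly_mult)
      with nz show ?thesis by (simp add: rf_eval_def g_def)
    qed
    have "poly (common_den I f \<omega>) t * (a $ i $ j * (rf_eval (f i) t * rf_eval (f j) t * rf_eval \<omega> t))
      = \<sigma> * a $ i $ j * (poly (rf_num \<omega>) t * (poly (g i) t * poly (g j) t))" for i j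
      using nz by (simp add: eval_f L rf_eval_def[of \<omega>] power2_eq_square)
    then have "poly (common_den I f \<omega>) t * (a \<bullet> info_at f \<omega> t)
      = poly (\<Sum>i\<in>UNIV. \<Sum>j\<in>UNIV. smult (\<sigma> * a $ i $ j) (rf_num \<omega> * (g i * g j))) t"
      by (simp only: inner_vec_def info_at_def sum_distrib_left poly_sum poly_smult poly_mult
          vec_lambda_beta inner_real_def)
    then show ?thesis by (simp add: p_def algebra_simps)
  qed
  ultimately show thesis by (rule that)
qed

end

section \<open>Designs and information matrices\<close>

lemma fisher_info_eq_sum:
  assumes "finite A" and "set_pmf \<xi> \<subseteq> A"
  shows "fisher_info f \<omega> \<xi> = (\<Sum>t\<in>A. pmf \<xi> t *\<^sub>R info_at f \<omega> t)"
  unfolding fisher_info_def using assms by (intro integral_measure_pmf) auto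

lemma fisher_info_return [simp]: "fisher_info f \<omega> (return_pmf t) = info_at f \<omega> t"
  by (subst fisher_info_eq_sum[of "{t}"]) auto

lemma fisher_info_in_info_set:
  assumes "design I \<xi>"
  shows "fisher_info f \<omega> \<xi> \<in> info_set I f \<omega>"
proof -
  have "fisher_info f \<omega> \<xi> = (\<Sum>t\<in>set_pmf \<xi>. pmf \<xi> t *\<^sub>R info_at f \<omega> t)"
    using assms by (intro fisher_info_eq_sum) (auto simp: design_def)
  also have "\<dots> \<in> info_set I f \<omega>"
    unfolding info_set_def
    using assms by (intro convex_sum) (auto simp: design_def sum_pmf_eq_1 intro!: hull_inc)
  finally show ?thesis .
qed

text \<open>Choosing between two designs by a biased coin takes the same convex combination of their
  information matrices. The information matrices of designs thus form a convex set containing those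
  of the one-point designs.\<close>

lemma info_set_design:
  assumes "X \<in> info_set I f \<omega>"
  obtains \<xi> where "design I \<xi>" and "fisher_info f \<omega> \<xi> = X"
proof -
  let ?F = "{fisher_info f \<omega> \<xi> | \<xi>. design I \<xi>}"
  have "convex ?F"
  proof (rule convexI)
    fix X Y and a b :: real
    assume "X \<in> ?F" "Y \<in> ?F" and ab: "0 \<le> a" "0 \<le> b" "a + b = 1"
    then obtain \<xi> \<zeta> where X: "X = fisher_info f \<omega> \<xi>" "design I \<xi>"
      and Y: "Y = fisher_info f \<omega> \<zeta>" "design I \<zeta>"
      by auto
    define \<eta> where "\<eta> = bind_pmf (bernoulli_pmf a) (\<lambda>x. if x then \<xi> else \<zeta>)"
    let ?A = "set_pmf \<xi> \<union> set_pmf \<zeta>"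
    have A: "finite ?A" "set_pmf \<eta> \<subseteq> ?A"
      using X Y by (auto simp: design_def \<eta>_def split: if_splits)
    have "b = 1 - a" using ab by simp
    then have "pmf \<eta> t = a * pmf \<xi> t + b * pmf \<zeta> t" for t
      using ab by (simp add: \<eta>_def pmf_bind)
    then have "fisher_info f \<omega> \<eta> = a *\<^sub>R X + b *\<^sub>R Y"
      unfolding X Y
      by (subst (1 2 3) fisher_info_eq_sum[of ?A])
        (use A in \<open>auto simp: scaleR_sum_right scaleR_left_distrib sum.distrib\<close>)
    moreover have "design I \<eta>"
      using A X Y unfolding design_def by (meson Un_least finite_subset order_trans)
    ultimately show "a *\<^sub>R X + b *\<^sub>R Y \<in> ?F" by (auto intro: exI[of _ \<eta>])
  qed
  moreover have "info_at f \<omega> ` I \<subseteq> ?F"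
  proof
    fix X assume "X \<in> info_at f \<omega> ` I"
    then obtain t where "t \<in> I" "X = fisher_info f \<omega> (return_pmf t)" by auto
    then show "X \<in> ?F" by (auto simp: design_def simp del: fisher_info_return)
  qed
  ultimately have "info_set I f \<omega> \<subseteq> ?F"
    unfolding info_set_def by (intro hull_minimal)
  with assms that show thesis by blast
qed

text \<open>Finitely many of the superlevel sets at attained values always meet, so by compactness
  all of them do; a common point is a maximiser.\<close>

lemma attains_max_if_usc:
  fixes g :: "'a::t2_space \<Rightarrow> real"
  assumes "compact M" and "M \<noteq> {}" and closed: "\<And>z. closed {x \<in> M. g x \<ge> z}"
  obtains x where "x \<in> M" and "\<And>y. y \<in> M \<Longrightarrow> g y \<le> g x"
proof -
  have "M \<inter> (\<Inter>y\<in>M. {x \<in> M. g x \<ge> g y}) \<noteq> {}"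
  proof (rule compact_imp_fip_image)
    fix N assume N: "finite N" "N \<subseteq> M"
    show "M \<inter> (\<Inter>y\<in>N. {x \<in> M. g x \<ge> g y}) \<noteq> {}"
    proof (cases "N = {}")
      case False
      with N have "Max (g ` N) \<in> g ` N" by (intro Max_in) auto
      then obtain x where "x \<in> N" "Max (g ` N) = g x" by (rule imageE)
      with N have "g y \<le> g x" if "y \<in> N" for y
        using Max_ge[of "g ` N" "g y"] that by simp
      with N \<open>x \<in> N\<close> have "x \<in> M \<inter> (\<Inter>y\<in>N. {x \<in> M. g x \<ge> g y})" by blast
      then show ?thesis by blast
    qed (use \<open>M \<noteq> {}\<close> in simp)
  qed (use assms in auto)
  with that show thesis by auto
qed

context rational_model
begin

lemma info_at_eq: "info_at f \<omega> t = rf_eval \<omega> t *\<^sub>R outer (\<chi> i. rf_eval (f i) t)"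
  by (simp add: info_at_def outer_def vec_eq_iff)

lemma info_set_psd: "psd_on UNIV X" if "X \<in> info_set I f \<omega>"
proof -
  have "convex {X :: real^'m^'m. psd_on UNIV X}"
    by (rule convexI)
      (auto simp: psd_on_def matrix_vector_mult_add_rdistrib scaleR_matrix_vector_assoc[symmetric]
        inner_add_right intro!: add_nonneg_nonneg subspace_add[OF subspace_sym_mats]
        subspace_scale[OF subspace_sym_mats])
  moreover have "psd_on UNIV (info_at f \<omega> t)" if "t \<in> I" for t
  proof -
    have "info_at f \<omega> t \<in> sym_mats UNIV"
      by (simp add: sym_mats_def info_at_def transpose_def vec_eq_iff mult_ac)
    moreover have "x \<bullet> (info_at f \<omega> t *v x) = rf_eval \<omega> t * ((\<chi> i. rf_eval (f i) t) \<bullet> x)\<^sup>2" for x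
      by (simp add: info_at_eq scaleR_matrix_vector_assoc[symmetric] outer_mult_vec
          inner_commute[of x] power2_eq_square)
    ultimately show ?thesis
      using rf_eval_weight_pos[OF that] by (simp add: psd_on_def)
  qed
  ultimately have "info_set I f \<omega> \<subseteq> {X. psd_on UNIV X}"
    unfolding info_set_def by (intro hull_minimal) auto
  with that show ?thesis by auto
qed

lemma compact_info_set: "compact (info_set I f \<omega>)" if "compact I"
proof -
  \<comment> \<open>Division by zero yields 0, so a positive value of
    \<open>rf_eval \<omega>\<close> excludes a zero denominator.\<close>
  have "poly (rf_den \<omega>) t \<noteq> 0" if "t \<in> I" for t
    using rf_eval_weight_pos[OF that] by (auto simp: rf_eval_def)
  then have "continuous_on I (info_at f \<omega>)"
    unfolding info_at_def rf_eval_def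
    using finite_on by (intro continuous_intros) (auto simp: rf_finite_on_def)
  with that show ?thesis
    unfolding info_set_def by (intro compact_convex_hull compact_continuous_image)
qed

end

section \<open>Bound on the support size\<close>

theorem corollary18:
  fixes f :: "'m::finite \<Rightarrow> real poly fract" and \<omega> :: "real poly fract"
    and \<J> :: "real set set" and I :: "real set" and k1 k2 :: nat
    and \<Phi> :: "real^'m^'m \<Rightarrow> real"
    and R :: "('m, 'p::finite, 'k::finite, 'l::finite) sd_rep"
    and y :: real and W :: "'p \<Rightarrow> real^'k^'k" and \<pi> :: "real poly"
  assumes "finite \<J>" and "disjoint \<J>"
    and "\<And>J. J \<in> \<J> \<Longrightarrow> \<exists>a b. a \<le> b \<and> J = {a..b}"
    and "I = \<Union>\<J>"
    and "k1 = card {J \<in> \<J>. \<exists>a. J = {a}}"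
    and "k2 = card {J \<in> \<J>. \<exists>a b. a < b \<and> J = {a..b}}"
    and "rf_lin_indep f"
    and "\<And>i. rf_finite_on I (f i)"
    and "rf_num_den_pos_on I \<omega>"
    and clears_denominators: "\<And>i. rf_den ((f i)\<^sup>2 * \<omega>) dvd common_den I f \<omega>"
    and "admissible_via R \<Phi> I f \<omega>"
    and upper_semicontinuous: "\<And>z. closed {X \<in> info_set I f \<omega>. \<Phi> X \<ge> z}"
    and "P_optimal R I f \<omega> y W \<pi>"
    and "\<pi> \<noteq> 0"
  shows "\<exists>\<xi>. optimal_design \<Phi> I f \<omega> \<xi> \<and>
           real (card (set_pmf \<xi>)) \<le>
             min ((real k1 + 2 * real k2 + real_of_int (deg_bound I f \<omega>)) / 2)
                 (real_of_int (deg_bound I f \<omega>))"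
proof -
  interpret rational_model I f \<omega>
    using assms(8,9) clears_denominators by unfold_locales
  let ?M = "info_set I f \<omega>" and ?L = "common_den I f \<omega>"
  have rep: "sd_represents R \<Phi>" and strict: "strictly_feasible R ?M"
    using assms(11) by (auto simp: admissible_via_def)
  have wf: "sd_rep_wf R" using rep by (simp add: sd_represents_def)
  then have linA: "linear (opA R i)" and linC: "linear (opC R i)" for i
    by (auto simp: sd_rep_wf_def)
  have "compact I" using assms(1,3,4) by (auto intro!: compact_Union)
  moreover have "?M \<noteq> {}" using strict by (auto simp: strictly_feasible_def)
  ultimately obtain X where X: "X \<in> ?M" and X_max: "\<And>Y. Y \<in> ?M \<Longrightarrow> \<Phi> Y \<le> \<Phi> X"
    using attains_max_if_usc[OF compact_info_set _ upper_semicontinuous] by metis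
  obtain \<xi> where \<xi>: "design I \<xi>" "fisher_info f \<omega> \<xi> = X"
    using info_set_design[OF X] .
  have opt: "optimal_design \<Phi> I f \<omega> \<xi>"
    using \<xi> X_max[OF fisher_info_in_info_set] by (simp add: optimal_design_def)

  \<comment> \<open>The dual functional of (P), affine in \<open>X\<close>; affinity is what lets it
    be averaged over the support of a design.\<close>
  define G where "G V X = (\<Sum>i\<in>UNIV. V i \<bullet> (opA R i X + matD R i))" for V :: "'p \<Rightarrow> real^'k^'k" and X
  have G_affine: "G V X = (\<Sum>i\<in>UNIV. adjoint (opA R i) (V i)) \<bullet> X + (\<Sum>i\<in>UNIV. V i \<bullet> matD R i)" for V X
  proof -
    have "adjoint (opA R i) (V i) \<bullet> X = V i \<bullet> opA R i X" for i
      using adjoint_works[OF linA, of X i "V i"] by (simp add: inner_commute)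
    then show ?thesis by (simp add: G_def inner_add_right sum.distrib inner_sum_left)
  qed
  \<comment> \<open>This holds for arbitrary \<open>v\<close> and \<open>V\<close> because it serves
    twice: for the Lagrange multiplier, to make it feasible for (P), and for the given
    \<open>y\<close> and \<open>W\<close>, to bound the degree of \<open>\<pi>\<close>.\<close>
  have poly_G: "\<exists>p. int (degree p) \<le> deg_bound I f \<omega> \<and>
      (\<forall>t. poly ?L t \<noteq> 0 \<longrightarrow> poly p t = poly ?L t * (v - G V (info_at f \<omega> t)))" for v V
  proof -
    let ?a = "\<Sum>i\<in>UNIV. adjoint (opA R i) (V i)" and ?c = "v - (\<Sum>i\<in>UNIV. V i \<bullet> matD R i)"
    obtain p where deg: "int (degree p) \<le> deg_bound I f \<omega>"
      and p: "\<And>t. poly ?L t \<noteq> 0 \<Longrightarrow> poly p t = poly ?L t * (?c - ?a \<bullet> info_at f \<omega> t)"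
      by (rule dual_poly[of ?c ?a]) (rule that)
    have "?c - ?a \<bullet> Y = v - G V Y" for Y by (simp add: G_affine)
    with deg p show ?thesis by (intro exI[of _ p]) simp
  qed
  \<comment> \<open>Translates between the coordinatewise constraint of (P) and the functional form
    delivered by duality.\<close>
  have C_adj: "(\<Sum>i\<in>UNIV. adjoint (opC R i) (V i)) \<bullet> u = (\<Sum>i\<in>UNIV. V i \<bullet> opC R i u)" for V u
  proof -
    have "adjoint (opC R i) (V i) \<bullet> u = V i \<bullet> opC R i u" for i
      using adjoint_works[OF linC, of u i "V i"] by (simp add: inner_commute)
    then show ?thesis by (simp add: inner_sum_left)
  qed
  have feas: "P_feasible R I f \<omega> y W \<pi>" using assms(13) by (simp add: P_optimal_def)
  then have W_psd: "\<And>i. psd_on (block R i) (W i)" and W_B: "(\<Sum>i\<in>UNIV. W i \<bullet> matB R i) = -1"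
    and W_C: "\<And>j. j \<in> params R \<Longrightarrow> (\<Sum>i\<in>UNIV. adjoint (opC R i) (W i)) $ j = 0"
    and \<pi>_eq: "\<And>t. poly ?L t \<noteq> 0 \<Longrightarrow> poly \<pi> t = poly ?L t * (y - G W (info_at f \<omega> t))"
    and \<pi>_nonneg: "\<And>t. t \<in> I \<Longrightarrow> poly \<pi> t \<ge> 0"
    by (auto simp: P_feasible_def G_def)

  have "y \<le> \<Phi> X"
  proof -
    have "convex ?M" by (simp add: info_set_def)
    obtain V where V: "\<And>i. psd_on (block R i) (V i)" "(\<Sum>i\<in>UNIV. V i \<bullet> matB R i) = -1"
        "\<And>u. u \<in> coord_space (params R) \<Longrightarrow> (\<Sum>i\<in>UNIV. V i \<bullet> opC R i u) = 0"
        "\<And>Y. Y \<in> ?M \<Longrightarrow> (\<Sum>i\<in>UNIV. V i \<bullet> (opA R i Y + matD R i)) \<le> \<Phi> X"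
      by (rule strong_duality[OF rep \<open>convex ?M\<close> info_set_psd strict X_max]) (assumption | rule that)+
    then have V_le: "\<And>Y. Y \<in> ?M \<Longrightarrow> G V Y \<le> \<Phi> X" by (simp add: G_def)
    obtain p where p: "\<And>t. poly ?L t \<noteq> 0 \<Longrightarrow> poly p t = poly ?L t * (\<Phi> X - G V (info_at f \<omega> t))"
      using poly_G[of "\<Phi> X" V] by auto
    have "P_feasible R I f \<omega> (\<Phi> X) V p"
      unfolding P_feasible_def
    proof (intro conjI allI ballI impI)
      show "(\<Sum>i\<in>UNIV. adjoint (opC R i) (V i)) $ j = 0" if "j \<in> params R" for j
      proof -
        have "axis j 1 \<in> coord_space (params R)" using that by (auto simp: coord_space_def axis_def)
        from V(3)[OF this] show ?thesis unfolding C_adj[symmetric] by (simp only: inner_axis) simp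
      qed
      show "poly p t \<ge> 0" if "t \<in> I" for t
        using p[of t] common_den_pos[OF that] V_le[of "info_at f \<omega> t"] that
        by (simp add: info_set_def hull_inc)
    qed (use V p in \<open>auto simp: G_def\<close>)
    with assms(13) show ?thesis by (auto simp: P_optimal_def)
  qed

  have G_le: "G W (info_at f \<omega> t) \<le> y" if "t \<in> I" for t
    using \<pi>_eq[of t] \<pi>_nonneg[OF that] common_den_pos[OF that] by (simp add: zero_le_mult_iff)
  obtain u where u: "u \<in> coord_space (params R)"
    and lmi: "\<And>i. psd_on (block R i) (lmi R i X (\<Phi> X) u)"
    \<comment> \<open>The representation is applied at the level \<open>z = \<Phi> X\<close>
      itself.\<close>
    using rep info_set_psd[OF X] by (force simp: sd_represents_def)
  have "0 \<le> (\<Sum>i\<in>UNIV. W i \<bullet> lmi R i X (\<Phi> X) u)"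
    using W_psd lmi by (intro sum_nonneg psd_on_inner_nonneg) (auto simp: psd_on_def)
  also have "\<dots> = G W X + \<Phi> X * (\<Sum>i\<in>UNIV. W i \<bullet> matB R i) + (\<Sum>i\<in>UNIV. W i \<bullet> opC R i u)"
    by (simp add: lmi_def G_def inner_add_right sum.distrib sum_distrib_left)
  also have "(\<Sum>i\<in>UNIV. W i \<bullet> opC R i u) = 0"
  proof -
    have "(\<Sum>i\<in>UNIV. adjoint (opC R i) (W i)) $ j * u $ j = 0" for j
      using W_C[of j] u by (cases "j \<in> params R") (simp_all add: coord_space_def)
    then show ?thesis
      unfolding C_adj[symmetric] inner_vec_def[of _ u] inner_real_def by (simp only: sum.neutral_const)
  qed
  \<comment> \<open>The pairing equals \<open>G W X - \<Phi> X\<close>, so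
    \<open>\<Phi> X \<le> G W X\<close>.\<close>
  finally have "y \<le> G W X" using W_B \<open>y \<le> \<Phi> X\<close> by simp
  define Z where "Z = set_pmf \<xi>"
  have Z: "finite Z" "Z \<subseteq> I" using \<xi>(1) by (auto simp: design_def Z_def)
  have sum1: "(\<Sum>t\<in>Z. pmf \<xi> t) = 1" using Z by (intro sum_pmf_eq_1) (auto simp: Z_def)
  have "X = (\<Sum>t\<in>Z. pmf \<xi> t *\<^sub>R info_at f \<omega> t)"
    using fisher_info_eq_sum[of Z \<xi>] Z \<xi>(2) by (auto simp: Z_def)
  then have "G W X = (\<Sum>t\<in>Z. pmf \<xi> t * ((\<Sum>i\<in>UNIV. adjoint (opA R i) (W i)) \<bullet> info_at f \<omega> t))
      + (\<Sum>t\<in>Z. pmf \<xi> t) * (\<Sum>i\<in>UNIV. W i \<bullet> matD R i)"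
    unfolding G_affine by (simp add: inner_sum_right sum1)
  also have "\<dots> = (\<Sum>t\<in>Z. pmf \<xi> t * G W (info_at f \<omega> t))"
    unfolding G_affine by (simp add: sum_distrib_right sum.distrib distrib_left)
  \<comment> \<open>The average slack over the design is \<open>y - G W X\<close>, hence at most 0.
    As no slack on \<open>I\<close> is negative, each one vanishes at a point of positive
    weight.\<close>
  finally have "(\<Sum>t\<in>Z. pmf \<xi> t * (y - G W (info_at f \<omega> t))) = y - G W X"
    by (simp add: right_diff_distrib sum_subtractf sum_distrib_right[symmetric] sum1)
  with \<open>y \<le> G W X\<close> have "(\<Sum>t\<in>Z. pmf \<xi> t * (y - G W (info_at f \<omega> t))) \<le> 0" by simp
  moreover have nonneg: "pmf \<xi> t * (y - G W (info_at f \<omega> t)) \<ge> 0" if "t \<in> Z" for t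
    using G_le Z that by auto
  ultimately have "pmf \<xi> t * (y - G W (info_at f \<omega> t)) = 0" if "t \<in> Z" for t
    using sum_nonneg_eq_0_iff[OF Z(1) nonneg] sum_nonneg[of Z, OF nonneg] that by force
  then have slack: "y - G W (info_at f \<omega> t) = 0" if "t \<in> Z" for t
    using that by (auto simp: Z_def set_pmf_iff)
  have roots: "Z \<subseteq> {t \<in> \<Union>\<J>. poly \<pi> t = 0}"
  proof
    fix t assume "t \<in> Z"
    with Z have "t \<in> I" by auto
    with slack[OF \<open>t \<in> Z\<close>] \<pi>_eq[of t] common_den_pos[of t] assms(4)
    show "t \<in> {t \<in> \<Union>\<J>. poly \<pi> t = 0}" by auto
  qed

  obtain p where p: "int (degree p) \<le> deg_bound I f \<omega>"
      "\<And>t. poly ?L t \<noteq> 0 \<Longrightarrow> poly p t = poly ?L t * (y - G W (info_at f \<omega> t))"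
    using poly_G[of y W] by auto
  \<comment> \<open>Feasibility states no degree bound. It fixes \<open>\<pi>\<close> only off the
    zeros of \<open>?L\<close>; multiplying by \<open>?L\<close> removes this exception and
    identifies \<open>\<pi>\<close> with \<open>p\<close>.\<close>
  have "poly (?L * (\<pi> - p)) t = 0" for t
    using p(2)[of t] \<pi>_eq[of t] by (cases "poly ?L t = 0") auto
  then have "?L * (\<pi> - p) = 0" using poly_all_0_iff_0 by blast
  moreover have "?L \<noteq> 0" using common_den_pos Z set_pmf_not_empty[of \<xi>] unfolding Z_def by force
  ultimately have "\<pi> = p" by simp
  with p(1) have "int (degree \<pi>) \<le> deg_bound I f \<omega>" by simp
  then have deg: "real (degree \<pi>) \<le> real_of_int (deg_bound I f \<omega>)" by linarith
  \<comment> \<open>Zeros are counted with the actual degree of \<open>\<pi>\<close>, which may be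
    below \<open>deg_bound\<close>; both bounds are monotone in the degree.\<close>
  have "2 * card Z \<le> k1 + 2 * k2 + degree \<pi>"
    unfolding assms(5,6) using assms(1,3,14) \<pi>_nonneg[unfolded assms(4)] roots
    by (rule card_roots_bound)
  moreover have "card Z \<le> degree \<pi>"
    using card_mono[OF poly_roots_finite[OF assms(14)], of Z] card_poly_roots_bound[OF assms(14)] roots
    by force
  ultimately show ?thesis
    using opt deg by (intro exI[of _ \<xi>]) (auto simp: Z_def)
qed

end
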